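(* Let $R$ be a reduced commutative noetherian local ring of positive dimension and let $M$ be an $R$-module of finite length and of infinite projective dimension. Then $\operatorname{Supp}(\operatorname{Syz}_i(M))=\operatorname{Spec}(R)$ for all $i>0$.
   Context: For a finitely generated module $M$ over a local ring $R$, let $\cdots\to R^{\beta_{i+1}}\xrightarrow{f_{i+1}}R^{\beta_i}\xrightarrow{f_i}\cdots\to R^{\beta_0}\xrightarrow{f_0}M\to 0$ be the minimal free resolution. For $i>0$, $\operatorname{Syz}_i(M):=\operatorname{coker}(f_{i+1})=\ker(f_{i-1})$ is the $i$-th syzygy module. *)

theory Defs
  imports "HOL-Algebra.Module" "HOL-Algebra.Ring_Divisibility" "HOL-Library.Extended_Nat"
begin

section \<open>Rings\<close>

definition reduced_ring :: "('a, 'r) ring_scheme \<Rightarrow> bool" where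
  "reduced_ring R \<longleftrightarrow>
     cring R \<and> (\<forall>x\<in>carrier R. \<forall>n::nat. x [^]\<^bsub>R\<^esub> n = \<zero>\<^bsub>R\<^esub> \<longrightarrow> x = \<zero>\<^bsub>R\<^esub>)"

definition local_ring :: "('a, 'r) ring_scheme \<Rightarrow> bool" where
  "local_ring R \<longleftrightarrow> cring R \<and> (\<exists>!I. maximalideal I R)"

definition max_ideal :: "('a, 'r) ring_scheme \<Rightarrow> 'a set" where
  "max_ideal R = (THE I. maximalideal I R)"

definition Spec :: "('a, 'r) ring_scheme \<Rightarrow> 'a set set" where
  "Spec R = {P. primeideal P R}"

definition krull_dim :: "('a, 'r) ring_scheme \<Rightarrow> enat" where
  "krull_dim R =
     Sup {enat n | n. \<exists>P. (\<forall>i\<le>n. P i \<in> Spec R) \<and> (\<forall>i<n. P i \<subset> P (Suc i))}"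


section \<open>Modules\<close>

text \<open>
  The record \<^typ>\<open>('a, 'b) module\<close> extends the record of rings, so it has fields
  \<^const>\<open>monoid.mult\<close> and \<^const>\<open>one\<close>. They play no role in the locale \<^locale>\<open>module\<close> and are
  left \<^const>\<open>undefined\<close> in the modules constructed here.
\<close>

definition mod_hom ::
  "('a, 'r) ring_scheme \<Rightarrow> ('a, 'b, 'm) module_scheme \<Rightarrow> ('a, 'c, 'n) module_scheme \<Rightarrow> ('b \<Rightarrow> 'c) set"
  where
  "mod_hom R M N =
     {h \<in> hom (add_monoid M) (add_monoid N).
        \<forall>a\<in>carrier R. \<forall>x\<in>carrier M. h (a \<odot>\<^bsub>M\<^esub> x) = a \<odot>\<^bsub>N\<^esub> h x}"

definition quot_module ::
  "('a, 'b, 'm) module_scheme \<Rightarrow> 'b set \<Rightarrow> ('a, 'b set) module" where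
  "quot_module M N =
     \<lparr>carrier = a_rcosets\<^bsub>M\<^esub> N, monoid.mult = undefined, one = undefined,
      zero = N, add = (\<lambda>C D. C <+>\<^bsub>M\<^esub> D),
      smult = (\<lambda>a C. \<Union>x\<in>C. N +>\<^bsub>M\<^esub> (a \<odot>\<^bsub>M\<^esub> x))\<rparr>"

definition coker_module ::
  "('a, 'b, 'm) module_scheme \<Rightarrow> ('a, 'c, 'n) module_scheme \<Rightarrow> ('b \<Rightarrow> 'c) \<Rightarrow> ('a, 'c set) module"
  where
  "coker_module M N h = quot_module N (h ` carrier M)"

definition ideal_mult_module ::
  "('a, 'r) ring_scheme \<Rightarrow> 'a set \<Rightarrow> ('a, 'b, 'm) module_scheme \<Rightarrow> 'b set" where
  "ideal_mult_module R I M =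
     \<Inter>{N. submodule N R M \<and> (\<forall>a\<in>I. \<forall>x\<in>carrier M. a \<odot>\<^bsub>M\<^esub> x \<in> N)}"

text \<open>
  A module has finite length iff it has a composition series, that is, a finite chain of submodules
  from \<open>0\<close> to \<open>M\<close> into which no further submodule can be inserted.
\<close>

definition composition_series ::
  "('a, 'r) ring_scheme \<Rightarrow> ('a, 'b, 'm) module_scheme \<Rightarrow> nat \<Rightarrow> (nat \<Rightarrow> 'b set) \<Rightarrow> bool" where
  "composition_series R M n N \<longleftrightarrow>
     (\<forall>i\<le>n. submodule (N i) R M) \<and> N 0 = {\<zero>\<^bsub>M\<^esub>} \<and> N n = carrier M \<and>
     (\<forall>i<n. N i \<subset> N (Suc i) \<and> (\<nexists>L. submodule L R M \<and> N i \<subset> L \<and> L \<subset> N (Suc i)))"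

definition finite_length ::
  "('a, 'r) ring_scheme \<Rightarrow> ('a, 'b, 'm) module_scheme \<Rightarrow> bool" where
  "finite_length R M \<longleftrightarrow> module R M \<and> (\<exists>n N. composition_series R M n N)"

text \<open>
  The free module on a set \<open>B\<close>, realised as the finitely supported functions on \<open>B\<close> (extended by zero
  outside \<open>B\<close>). In particular \<open>R\<^sup>n\<close> is the free module on \<open>{..<n}\<close>.
\<close>

definition free_module ::
  "('a, 'r) ring_scheme \<Rightarrow> 'x set \<Rightarrow> ('a, 'x \<Rightarrow> 'a) module" where
  "free_module R B =
     \<lparr>carrier = {v. (\<forall>b. v b \<in> carrier R) \<and> (\<forall>b. b \<notin> B \<longrightarrow> v b = \<zero>\<^bsub>R\<^esub>) \<and> finite {b. v b \<noteq> \<zero>\<^bsub>R\<^esub>}},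
      monoid.mult = undefined, one = undefined,
      zero = (\<lambda>_. \<zero>\<^bsub>R\<^esub>), add = (\<lambda>u v b. u b \<oplus>\<^bsub>R\<^esub> v b),
      smult = (\<lambda>a v b. a \<otimes>\<^bsub>R\<^esub> v b)\<rparr>"

text \<open>
  A module is projective iff it is a direct summand of a free module. A basis taken from the type of
  the elements of \<open>P\<close> suffices: if \<open>P\<close> is a retract of some free module, then it is also a retract of
  the free module on the set \<^term>\<open>carrier P\<close>.
\<close>

definition projective_module ::
  "('a, 'r) ring_scheme \<Rightarrow> ('a, 'p, 'm) module_scheme \<Rightarrow> bool" where
  "projective_module R P \<longleftrightarrow>
     module R P \<and>
     (\<exists>(B::'p set) i p.
        i \<in> mod_hom R P (free_module R B) \<and> p \<in> mod_hom R (free_module R B) P \<and>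
        (\<forall>x\<in>carrier P. p (i x) = x))"


section \<open>Resolutions and projective dimension\<close>

text \<open>
  Exactness of \<open>\<cdots> \<rightarrow> F 2 \<rightarrow> F 1 \<rightarrow> F 0 \<rightarrow> M \<rightarrow> 0\<close>, with maps \<open>f i : F i \<rightarrow> F (i - 1)\<close> for \<open>i > 0\<close> and
  augmentation \<open>\<epsilon> : F 0 \<rightarrow> M\<close>. The value \<open>f 0\<close> is unused, since \<open>\<epsilon>\<close> has a different type.
\<close>

definition resolution ::
  "('a, 'r) ring_scheme \<Rightarrow> ('a, 'b, 'm) module_scheme \<Rightarrow>
   (nat \<Rightarrow> ('a, 'c) module) \<Rightarrow> (nat \<Rightarrow> 'c \<Rightarrow> 'c) \<Rightarrow> ('c \<Rightarrow> 'b) \<Rightarrow> bool" where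
  "resolution R M F f \<epsilon> \<longleftrightarrow>
     module R M \<and> (\<forall>i. module R (F i)) \<and>
     \<epsilon> \<in> mod_hom R (F 0) M \<and> (\<forall>i. f (Suc i) \<in> mod_hom R (F (Suc i)) (F i)) \<and>
     \<epsilon> ` carrier (F 0) = carrier M \<and>
     f 1 ` carrier (F 1) = a_kernel (F 0) M \<epsilon> \<and>
     (\<forall>i. f (Suc (Suc i)) ` carrier (F (Suc (Suc i))) = a_kernel (F (Suc i)) (F i) (f (Suc i)))"

text \<open>
  The projective dimension is the least length of a projective resolution, and \<open>\<infinity>\<close> if there is no
  finite one. The resolving modules have their elements in the type \<^typ>\<open>('a + 'b) list\<close>. This is no
  restriction: the type is infinite and at least as large as \<open>R\<close> and \<open>M\<close>; and if \<open>M\<close> has a projective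
  resolution of length \<open>n\<close> then, by Schanuel's lemma, it has one by modules of cardinality at most
  \<open>max |R| |M| \<aleph>\<^sub>0\<close> (take successive free covers on the underlying sets and stop at the \<open>n\<close>-th kernel).
\<close>

definition proj_dim ::
  "('a, 'r) ring_scheme \<Rightarrow> ('a, 'b, 'm) module_scheme \<Rightarrow> enat" where
  "proj_dim R M =
     Inf {enat n | n. \<exists>(P :: nat \<Rightarrow> ('a, ('a + 'b) list) module) d \<epsilon>.
            resolution R M P d \<epsilon> \<and> (\<forall>i. projective_module R (P i)) \<and>
            (\<forall>i>n. carrier (P i) = {\<zero>\<^bsub>P i\<^esub>})}"

text \<open>
  Over a local ring, minimality means that each \<open>f (Suc i)\<close> maps into \<open>\<mm> F i\<close>.
\<close>

definition minimal_free_resolution ::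
  "('a, 'r) ring_scheme \<Rightarrow> ('a, 'b, 'm) module_scheme \<Rightarrow> (nat \<Rightarrow> nat) \<Rightarrow>
   (nat \<Rightarrow> (nat \<Rightarrow> 'a) \<Rightarrow> (nat \<Rightarrow> 'a)) \<Rightarrow> ((nat \<Rightarrow> 'a) \<Rightarrow> 'b) \<Rightarrow> bool" where
  "minimal_free_resolution R M \<beta> f \<epsilon> \<longleftrightarrow>
     resolution R M (\<lambda>i. free_module R {..<\<beta> i}) f \<epsilon> \<and>
     (\<forall>i. f (Suc i) ` carrier (free_module R {..<\<beta> (Suc i)})
            \<subseteq> ideal_mult_module R (max_ideal R) (free_module R {..<\<beta> i}))"

text \<open>The \<open>i\<close>-th syzygy module \<open>coker (f (i + 1))\<close>, for \<open>i > 0\<close>.\<close>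

definition Syz ::
  "('a, 'r) ring_scheme \<Rightarrow> (nat \<Rightarrow> nat) \<Rightarrow> (nat \<Rightarrow> (nat \<Rightarrow> 'a) \<Rightarrow> (nat \<Rightarrow> 'a)) \<Rightarrow> nat \<Rightarrow>
   ('a, (nat \<Rightarrow> 'a) set) module" where
  "Syz R \<beta> f i =
     coker_module (free_module R {..<\<beta> (Suc i)}) (free_module R {..<\<beta> i}) (f (Suc i))"


section \<open>Localization and support\<close>

text \<open>
  The localization \<open>M\<^sub>P\<close> at a prime ideal \<open>P\<close>, as an \<open>R\<close>-module. The pair \<open>(x, s)\<close> represents the
  fraction \<open>x / s\<close>.
\<close>

definition loc_rel ::
  "('a, 'r) ring_scheme \<Rightarrow> ('a, 'b, 'm) module_scheme \<Rightarrow> 'a set \<Rightarrow> (('b \<times> 'a) \<times> ('b \<times> 'a)) set"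
  where
  "loc_rel R M P =
     {((x, s), (y, t)). x \<in> carrier M \<and> y \<in> carrier M \<and> s \<in> carrier R - P \<and> t \<in> carrier R - P \<and>
        (\<exists>u\<in>carrier R - P. u \<odot>\<^bsub>M\<^esub> (t \<odot>\<^bsub>M\<^esub> x) = u \<odot>\<^bsub>M\<^esub> (s \<odot>\<^bsub>M\<^esub> y))}"

definition localization ::
  "('a, 'r) ring_scheme \<Rightarrow> ('a, 'b, 'm) module_scheme \<Rightarrow> 'a set \<Rightarrow> ('a, ('b \<times> 'a) set) module"
  where
  "localization R M P =
     \<lparr>carrier = (carrier M \<times> (carrier R - P)) // loc_rel R M P,
      monoid.mult = undefined, one = undefined,
      zero = loc_rel R M P `` {(\<zero>\<^bsub>M\<^esub>, \<one>\<^bsub>R\<^esub>)},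
      add = (\<lambda>C D. \<Union>(x, s)\<in>C. \<Union>(y, t)\<in>D.
               loc_rel R M P `` {(t \<odot>\<^bsub>M\<^esub> x \<oplus>\<^bsub>M\<^esub> s \<odot>\<^bsub>M\<^esub> y, s \<otimes>\<^bsub>R\<^esub> t)}),
      smult = (\<lambda>a C. \<Union>(x, s)\<in>C. loc_rel R M P `` {(a \<odot>\<^bsub>M\<^esub> x, s)})\<rparr>"

definition Supp ::
  "('a, 'r) ring_scheme \<Rightarrow> ('a, 'b, 'm) module_scheme \<Rightarrow> 'a set set" where
  "Supp R M =
     {P \<in> Spec R. carrier (localization R M P) \<noteq> {\<zero>\<^bsub>localization R M P\<^esub>}}"

end

theory Submission
  imports Defs
begin

text \<open>
  The image of \<open>f i\<close> is isomorphic to the \<open>i\<close>-th syzygy module, a submodule of the free module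
  \<open>F (i - 1)\<close>. Suppose that it vanishes at some prime, hence also at a minimal prime \<open>P\<close> below it. As
  \<open>R\<close> is reduced, \<open>R\<^sub>P\<close> is a field. As \<open>R\<close> is local of positive dimension, \<open>P\<close> is not the maximal
  ideal, so that the finite length module \<open>M\<close> vanishes at \<open>P\<close>. Localizing the resolution at \<open>P\<close>
  therefore gives an exact sequence \<open>\<cdots> \<rightarrow> F 1 \<rightarrow> F 0 \<rightarrow> 0\<close> of vector spaces, and the rank of the image
  of \<open>f i\<close> is \<open>\<beta> (i - 1) - \<beta> (i - 2) + \<dots>\<close>, a number that does not depend on \<open>P\<close>
  (\<open>rank_of_boundaries\<close>). If it is zero at one minimal prime, then it is zero at all of them, so the
  image of \<open>f i\<close> vanishes at every minimal prime. A reduced ring embeds into the product of its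
  localizations at minimal primes (\<open>reduced_zero_if_locally_zero\<close>), so \<open>f i = 0\<close>. Then the
  resolution can be cut off after \<open>F (i - 1)\<close> and the projective dimension of \<open>M\<close> is finite
  (\<open>proj_dim_le_of_zero_boundary\<close>), a contradiction.

  Minimal primes enter only through the property that every element of \<open>P\<close> is killed by an element
  outside \<open>P\<close>; enough of them are provided by \<open>maximal_submonoid_prime\<close>. Ranks at \<open>P\<close> are computed
  without forming vector spaces over \<open>R\<^sub>P\<close>: the preimage in \<open>M\<close> of the span in \<open>M\<^sub>P\<close> is a closure
  operator with the exchange property (\<open>pregeometry_loc_span\<close>), its bases have a well-defined
  cardinality, and this cardinality is additive along homomorphisms (\<open>basis_of_kernel_and_image\<close>).
\<close>


section \<open>Pregeometries and their bases\<close>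

definition independent_in :: "('b set \<Rightarrow> 'b set) \<Rightarrow> 'b set \<Rightarrow> bool" where
  "independent_in cl S \<longleftrightarrow> (\<forall>s\<in>S. s \<notin> cl (S - {s}))"

definition basis_of :: "('b set \<Rightarrow> 'b set) \<Rightarrow> 'b set \<Rightarrow> 'b set \<Rightarrow> bool" where
  "basis_of cl Y S \<longleftrightarrow> S \<subseteq> Y \<and> finite S \<and> independent_in cl S \<and> Y \<subseteq> cl S"

text \<open>
  The rank of an \<open>R\<^sub>P\<close>-vector space \<open>M\<^sub>P\<close> is needed for submodules of different modules and for
  different primes. It depends only on the closure operator that sends a subset of \<open>M\<close> to the
  elements of \<open>M\<close> whose image in \<open>M\<^sub>P\<close> lies in its linear span, so it suffices to count bases of a
  closure operator with the exchange property.
\<close>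

locale pregeometry =
  fixes E :: "'b set" and cl :: "'b set \<Rightarrow> 'b set"
  assumes extensive: "X \<subseteq> E \<Longrightarrow> X \<subseteq> cl X"
    and cl_least: "Y \<subseteq> E \<Longrightarrow> X \<subseteq> cl Y \<Longrightarrow> cl X \<subseteq> cl Y"
    and exchange: "S \<subseteq> E \<Longrightarrow> x \<in> E \<Longrightarrow> y \<in> E \<Longrightarrow> x \<in> cl (insert y S) \<Longrightarrow> x \<notin> cl S
      \<Longrightarrow> y \<in> cl (insert x S)"
begin

lemma cl_mono: "X \<subseteq> Y \<Longrightarrow> Y \<subseteq> E \<Longrightarrow> cl X \<subseteq> cl Y"
  using cl_least extensive by blast

lemma independent_insert:
  assumes "S \<subseteq> E" "x \<in> E" "independent_in cl S" "x \<notin> cl S"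
  shows "independent_in cl (insert x S)"
  unfolding independent_in_def
proof
  fix s assume s: "s \<in> insert x S"
  show "s \<notin> cl (insert x S - {s})"
  proof (cases "s = x")
    case True
    then show ?thesis
      using assms(1,4) cl_mono[of "insert x S - {s}" S] by auto
  next
    case False
    then have sS: "s \<in> S" using s by simp
    have eq: "insert x S - {s} = insert x (S - {s})" using False by blast
    have ins: "insert s (S - {s}) = S" using sS by blast
    have "s \<notin> cl (S - {s})" using assms(3) sS by (simp add: independent_in_def)
    then have "s \<notin> cl (insert x (S - {s}))"
      using exchange[of "S - {s}" s x, unfolded ins] assms(1,2,4) sS by blast
    then show ?thesis unfolding eq .
  qed
qed

text \<open>
  Steinitz exchange. Some \<open>w \<in> W\<close> lies outside the closure of \<open>S - {s}\<close>, as otherwise \<open>s\<close> would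
  lie in it; replacing \<open>s\<close> by \<open>w\<close> keeps \<open>S\<close> independent and moves it closer to \<open>W\<close>.
\<close>

lemma independent_card_le:
  assumes "finite S" "finite W" "S \<subseteq> E" "W \<subseteq> E" "independent_in cl S" "S \<subseteq> cl W"
  shows "card S \<le> card W"
  using assms
proof (induction "card (S - W)" arbitrary: S)
  case 0
  then have "S \<subseteq> W" by simp
  then show ?case using 0 by (simp add: card_mono)
next
  case (Suc n)
  then obtain s where s: "s \<in> S" "s \<notin> W"
    by (metis DiffE card.empty ex_in_conv nat.distinct(1))
  define S0 where "S0 = S - {s}"
  have sS0: "s \<notin> cl S0" using Suc.prems(5) s by (simp add: independent_in_def S0_def)
  have S0E: "S0 \<subseteq> E" using Suc.prems(3) S0_def by blast
  have "\<not> W \<subseteq> cl S0"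
    using cl_least[OF S0E, of W] Suc.prems(6) s sS0 by blast
  then obtain w where w: "w \<in> W" "w \<notin> cl S0" by blast
  have wS0: "w \<notin> S0" using w extensive[OF S0E] by blast
  have ind0: "independent_in cl S0"
    unfolding independent_in_def
  proof
    fix t assume t: "t \<in> S0"
    have "cl (S0 - {t}) \<subseteq> cl (S - {t})"
      using cl_mono[of "S0 - {t}" "S - {t}"] Suc.prems(3) S0_def by blast
    moreover have "t \<notin> cl (S - {t})"
      using t Suc.prems(5) by (auto simp: independent_in_def S0_def)
    ultimately show "t \<notin> cl (S0 - {t})" by blast
  qed
  have ind: "independent_in cl (insert w S0)"
    by (rule independent_insert[OF S0E subsetD[OF Suc.prems(4) w(1)] ind0 w(2)])
  have c: "card (insert w S0) = card S"
    using wS0 card_Suc_Diff1[OF Suc.prems(1) s(1)] Suc.prems(1) by (simp add: S0_def)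
  have "insert w S0 - W = (S - W) - {s}" using w s S0_def by blast
  then have "n = card (insert w S0 - W)"
    using Suc.hyps(2) s Suc.prems(1) by simp
  moreover have "insert w S0 \<subseteq> cl W"
    using w Suc.prems(4,6) extensive[of W] S0_def by blast
  ultimately have "card (insert w S0) \<le> card W"
    using Suc.prems(1,2,4) S0E w(1) ind
    by (intro Suc.hyps(1)) (auto simp: S0_def)
  then show ?case using c by simp
qed

lemma basis_card_unique:
  assumes "basis_of cl Y S" "basis_of cl Y T" "Y \<subseteq> E"
  shows "card S = card T"
  using assms independent_card_le[of S T] independent_card_le[of T S]
  unfolding basis_of_def by fastforce

text \<open>
  An independent subset of \<open>Y\<close> of greatest cardinality spans \<open>Y\<close>; the cardinalities are bounded
  by the Steinitz lemma.
\<close>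

lemma basis_exists:
  assumes "finite W" "W \<subseteq> E" "Y \<subseteq> cl W" "Y \<subseteq> E"
  shows "\<exists>S. basis_of cl Y S"
proof -
  let ?I = "\<lambda>S. finite S \<and> S \<subseteq> Y \<and> independent_in cl S"
  have "?I {}" by (simp add: independent_in_def)
  moreover have "\<forall>S. ?I S \<longrightarrow> card S < Suc (card W)"
    using independent_card_le[of _ W] assms by (metis le_imp_less_Suc order_trans)
  ultimately obtain S where S: "?I S" and max: "\<And>T. ?I T \<Longrightarrow> card T \<le> card S"
    using ex_has_greatest_nat[of ?I "{}" card "Suc (card W)"] by blast
  have "Y \<subseteq> cl S"
  proof
    fix y assume y: "y \<in> Y"
    show "y \<in> cl S"
    proof (rule ccontr)
      assume n: "y \<notin> cl S"
      have SE: "S \<subseteq> E" using S assms(4) by blast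
      have "?I (insert y S)"
        using S y independent_insert[OF SE _ _ n] assms(4) by blast
      then have "card (insert y S) \<le> card S" using max by blast
      moreover have "y \<notin> S" using n extensive[OF SE] by blast
      ultimately show False using S by simp
    qed
  qed
  then show ?thesis using S unfolding basis_of_def by blast
qed

end


section \<open>Primes at which the localization is a field\<close>

text \<open>
  This says that the localization \<open>R\<^sub>P\<close> is a field: its maximal ideal \<open>P R\<^sub>P\<close> vanishes. In a
  reduced ring these are exactly the minimal primes.
\<close>

locale locally_field_prime = primeideal P R for P and R (structure) +
  assumes killed_outside: "a \<in> P \<Longrightarrow> \<exists>u\<in>carrier R - P. u \<otimes> a = \<zero>"

text \<open>
  The complement of a maximal multiplicative set \<open>V \<supseteq> W\<close> avoiding \<open>0\<close> is such a prime. By maximality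
  every \<open>a \<notin> V\<close> satisfies \<open>v a\<^sup>n = 0\<close> for some \<open>v \<in> V\<close>, and then \<open>v a\<close> is nilpotent, hence zero.
  The elements killed by some member of \<open>V\<close> form an ideal. With \<open>W\<close> the complement of a prime this
  yields a minimal prime below it; with \<open>W\<close> the powers of an element, a minimal prime that does not
  contain that element.
\<close>

lemma (in cring) maximal_submonoid_prime:
  assumes red: "reduced_ring R"
    and W: "W \<subseteq> carrier R" "\<one> \<in> W" "\<And>a b. a \<in> W \<Longrightarrow> b \<in> W \<Longrightarrow> a \<otimes> b \<in> W" "\<zero> \<notin> W"
  shows "\<exists>P. locally_field_prime P R \<and> P \<inter> W = {}"
proof -
  let ?A = "{V. W \<subseteq> V \<and> V \<subseteq> carrier R \<and> (\<forall>a\<in>V. \<forall>b\<in>V. a \<otimes> b \<in> V) \<and> \<zero> \<notin> V}"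
  have "\<exists>V\<in>?A. \<forall>X\<in>?A. V \<subseteq> X \<longrightarrow> X = V"
  proof (rule subset_Zorn_nonempty)
    have "W \<in> ?A" using W by simp
    then show "?A \<noteq> {}" by (metis empty_iff)
  next
    fix C assume C: "C \<noteq> {}" "subset.chain ?A C"
    have CA: "C \<subseteq> ?A" using C(2) by (auto simp: subset_chain_def)
    have "a \<otimes> b \<in> \<Union>C" if ab: "a \<in> \<Union>C" "b \<in> \<Union>C" for a b
    proof -
      obtain V1 V2 where V: "a \<in> V1" "V1 \<in> C" "b \<in> V2" "V2 \<in> C" using ab by blast
      then have "V1 \<subseteq> V2 \<or> V2 \<subseteq> V1" using C(2) by (auto simp: subset_chain_def)
      then obtain V where "V \<in> C" "a \<in> V" "b \<in> V" using V by blast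
      then show ?thesis using CA by blast
    qed
    moreover have CW: "W \<subseteq> V \<and> V \<subseteq> carrier R \<and> \<zero> \<notin> V" if "V \<in> C" for V
      using CA that by auto
    moreover have "W \<subseteq> \<Union>C" using CW C(1) by blast
    moreover have "\<Union>C \<subseteq> carrier R" "\<zero> \<notin> \<Union>C" using CW by blast+
    ultimately show "\<Union>C \<in> ?A" by simp
  qed
  then obtain V where VA: "V \<in> ?A" and maxA: "\<forall>X\<in>?A. V \<subseteq> X \<longrightarrow> X = V" ..
  then have V: "W \<subseteq> V" "V \<subseteq> carrier R" "\<zero> \<notin> V"
    and Vm: "\<And>a b. a \<in> V \<Longrightarrow> b \<in> V \<Longrightarrow> a \<otimes> b \<in> V"
    by auto
  have oneV: "\<one> \<in> V" using V(1) W(2) by blast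
  have Vpow: "v [^] (n::nat) \<in> V" if "v \<in> V" for v n
    using that by (induction n) (auto simp: oneV Vm)
  have killed: "\<exists>u\<in>V. u \<otimes> a = \<zero>" if a: "a \<in> carrier R - V" for a
  proof -
    define X where "X = {v \<otimes> a [^] (n::nat) | v n. v \<in> V}"
    have VX: "V \<subseteq> X"
    proof
      fix v assume "v \<in> V"
      then have "v = v \<otimes> a [^] (0::nat)" "v \<in> V" using V(2) by auto
      then show "v \<in> X" unfolding X_def by blast
    qed
    have "a = \<one> \<otimes> a [^] (1::nat)" using a by simp
    then have aX: "a \<in> X" unfolding X_def using oneV by blast
    have Xc: "X \<subseteq> carrier R" unfolding X_def using V(2) a by auto
    have Xm: "\<forall>x\<in>X. \<forall>y\<in>X. x \<otimes> y \<in> X"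
    proof (intro ballI)
      fix x y assume "x \<in> X" "y \<in> X"
      then obtain v n w m where e: "x = v \<otimes> a [^] (n::nat)" "y = w \<otimes> a [^] (m::nat)"
        and vw: "v \<in> V" "w \<in> V" unfolding X_def by blast
      have "v \<in> carrier R" "w \<in> carrier R" "a \<in> carrier R" using vw V(2) a by auto
      then have "x \<otimes> y = (v \<otimes> w) \<otimes> a [^] (n + m)"
        unfolding e by (simp add: nat_pow_mult[symmetric] m_ac)
      then show "x \<otimes> y \<in> X" unfolding X_def using Vm vw by blast
    qed
    have "\<zero> \<in> X"
    proof (rule ccontr)
      assume "\<zero> \<notin> X"
      then have "X \<in> ?A" using Xc Xm VX V(1) by simp
      then have "X = V" using maxA VX by blast
      then show False using aX a by blast
    qed
    then obtain v n where v: "v \<in> V" "\<zero> = v \<otimes> a [^] (n::nat)" unfolding X_def by blast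
    have c: "v \<in> carrier R" "a \<in> carrier R" using v V(2) a by auto
    have "(v \<otimes> a) [^] Suc n = v [^] n \<otimes> a \<otimes> (v \<otimes> a [^] n)"
      using c by (simp add: nat_pow_distrib m_ac)
    also have "\<dots> = \<zero>" unfolding v(2)[symmetric] using c by simp
    finally have "v \<otimes> a = \<zero>" using red c unfolding reduced_ring_def by (meson m_closed)
    then show ?thesis using v by blast
  qed
  define P where "P = carrier R - V"
  have notP: "a \<in> P \<longleftrightarrow> a \<in> carrier R \<and> (\<exists>u\<in>V. u \<otimes> a = \<zero>)" for a
    using killed Vm V(3) unfolding P_def by (metis Diff_iff)
  have "ideal P R"
  proof (rule idealI)
    show "ring R" by (rule ring_axioms)
    show "subgroup P (add_monoid R)"
    proof (rule add.subgroupI)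
      show "P \<subseteq> carrier R" unfolding P_def by blast
      show "P \<noteq> {}" using V(3) unfolding P_def by blast
    next
      fix a assume "a \<in> P"
      then obtain u where "a \<in> carrier R" "u \<in> V" "u \<otimes> a = \<zero>" using notP by blast
      then show "\<ominus> a \<in> P" using notP V(2) r_minus[of u a] by auto
    next
      fix a b assume "a \<in> P" "b \<in> P"
      then obtain u v where uv: "a \<in> carrier R" "u \<in> V" "u \<otimes> a = \<zero>"
        "b \<in> carrier R" "v \<in> V" "v \<otimes> b = \<zero>" using notP by blast
      have c: "u \<in> carrier R" "v \<in> carrier R" using uv V(2) by auto
      have "(u \<otimes> v) \<otimes> (a \<oplus> b) = v \<otimes> (u \<otimes> a) \<oplus> u \<otimes> (v \<otimes> b)"
        using uv(1,4) c by (simp add: r_distr m_ac)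
      then have "(u \<otimes> v) \<otimes> (a \<oplus> b) = \<zero>" using uv c by simp
      then show "a \<oplus> b \<in> P" using notP uv Vm by blast
    qed
  next
    fix a x assume "a \<in> P" and x: "x \<in> carrier R"
    then obtain u where u: "a \<in> carrier R" "u \<in> V" "u \<otimes> a = \<zero>" using notP by blast
    have uc: "u \<in> carrier R" using u V(2) by blast
    have "u \<otimes> (x \<otimes> a) = x \<otimes> (u \<otimes> a)" using u(1) uc x by (simp add: m_ac)
    then have "u \<otimes> (x \<otimes> a) = \<zero>" using u x by simp
    then show "x \<otimes> a \<in> P" using notP u x by blast
    then show "a \<otimes> x \<in> P" using m_comm u x by simp
  qed
  then have "primeideal P R"
  proof (rule primeidealI)
    show "cring R" by (rule is_cring)
    show "carrier R \<noteq> P" using oneV unfolding P_def by blast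
    show "a \<in> P \<or> b \<in> P" if "a \<in> carrier R" "b \<in> carrier R" "a \<otimes> b \<in> P" for a b
      using that Vm unfolding P_def by blast
  qed
  moreover have "carrier R - P = V" using V(2) unfolding P_def by blast
  ultimately have "locally_field_prime P R"
    using notP by (simp add: locally_field_prime_def locally_field_prime_axioms_def)
  moreover have "P \<inter> W = {}" using V(1) unfolding P_def by blast
  ultimately show ?thesis by blast
qed


section \<open>Spans after localization\<close>

text \<open>
  The saturated submodules of \<open>M\<close> are the preimages of the submodules of \<open>M\<^sub>P\<close>, and
  \<open>loc_span R P M X\<close> is the preimage of the \<open>R\<^sub>P\<close>-span of the image of \<open>X\<close>. Working with them replaces
  fractions and linear combinations by closure properties.
\<close>

definition saturated :: "('a, 'r) ring_scheme \<Rightarrow> 'a set \<Rightarrow> ('a, 'b, 'm) module_scheme \<Rightarrow> 'b set \<Rightarrow> bool" where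
  "saturated R P M N \<longleftrightarrow>
     submodule N R M \<and> (\<forall>u\<in>carrier R - P. \<forall>x\<in>carrier M. u \<odot>\<^bsub>M\<^esub> x \<in> N \<longrightarrow> x \<in> N)"

definition loc_span :: "('a, 'r) ring_scheme \<Rightarrow> 'a set \<Rightarrow> ('a, 'b, 'm) module_scheme \<Rightarrow> 'b set \<Rightarrow> 'b set" where
  "loc_span R P M X = \<Inter>{N. saturated R P M N \<and> X \<subseteq> N}"

context module
begin

lemma saturatedI:
  assumes "N \<subseteq> carrier M" "\<zero>\<^bsub>M\<^esub> \<in> N"
    and "\<And>x y. x \<in> N \<Longrightarrow> y \<in> N \<Longrightarrow> x \<oplus>\<^bsub>M\<^esub> y \<in> N"
    and "\<And>a x. a \<in> carrier R \<Longrightarrow> x \<in> N \<Longrightarrow> a \<odot>\<^bsub>M\<^esub> x \<in> N"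
    and "\<And>u x. u \<in> carrier R - P \<Longrightarrow> x \<in> carrier M \<Longrightarrow> u \<odot>\<^bsub>M\<^esub> x \<in> N \<Longrightarrow> x \<in> N"
  shows "saturated R P M N"
  unfolding saturated_def
proof
  show "submodule N R M"
  proof (rule submoduleI)
    fix x assume x: "x \<in> N"
    then have "\<ominus>\<^bsub>M\<^esub> x = (\<ominus> \<one>) \<odot>\<^bsub>M\<^esub> x"
      using smult_l_minus[of \<one> x] assms(1) by auto
    then show "\<ominus>\<^bsub>M\<^esub> x \<in> N" using assms(4) x by simp
  qed (fact assms(1-4))+
  show "\<forall>u\<in>carrier R - P. \<forall>x\<in>carrier M. u \<odot>\<^bsub>M\<^esub> x \<in> N \<longrightarrow> x \<in> N"
    by (intro ballI impI) (fact assms(5))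
qed

lemma submodule_zero:
  assumes "submodule N R M"
  shows "\<zero>\<^bsub>M\<^esub> \<in> N"
  using subgroup.one_closed[OF submodule.axioms(1)[OF assms]] by simp

lemma saturatedD:
  assumes "saturated R P M N"
  shows "N \<subseteq> carrier M" "\<zero>\<^bsub>M\<^esub> \<in> N"
    and "\<And>x. x \<in> N \<Longrightarrow> \<ominus>\<^bsub>M\<^esub> x \<in> N"
    and "\<And>x y. x \<in> N \<Longrightarrow> y \<in> N \<Longrightarrow> x \<oplus>\<^bsub>M\<^esub> y \<in> N"
    and "\<And>a x. a \<in> carrier R \<Longrightarrow> x \<in> N \<Longrightarrow> a \<odot>\<^bsub>M\<^esub> x \<in> N"
    and "\<And>u x. u \<in> carrier R - P \<Longrightarrow> x \<in> carrier M \<Longrightarrow> u \<odot>\<^bsub>M\<^esub> x \<in> N \<Longrightarrow> x \<in> N"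
proof -
  have N: "submodule N R M" using assms by (simp add: saturated_def)
  show "N \<subseteq> carrier M" "\<zero>\<^bsub>M\<^esub> \<in> N" by (fact submoduleE(1)[OF N] submodule_zero[OF N])+
  show "\<ominus>\<^bsub>M\<^esub> x \<in> N" if "x \<in> N" for x by (fact submoduleE(3)[OF N that])
  show "x \<oplus>\<^bsub>M\<^esub> y \<in> N" if "x \<in> N" "y \<in> N" for x y by (fact submoduleE(5)[OF N that])
  show "a \<odot>\<^bsub>M\<^esub> x \<in> N" if "a \<in> carrier R" "x \<in> N" for a x by (fact submoduleE(4)[OF N that])
  show "x \<in> N" if "u \<in> carrier R - P" "x \<in> carrier M" "u \<odot>\<^bsub>M\<^esub> x \<in> N" for u x
    using assms that by (simp add: saturated_def)
qed

lemma saturated_carrier: "saturated R P M (carrier M)"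
  by (rule saturatedI) auto

lemma subset_loc_span: "X \<subseteq> loc_span R P M X"
  unfolding loc_span_def by blast

lemma loc_span_least: "saturated R P M N \<Longrightarrow> X \<subseteq> N \<Longrightarrow> loc_span R P M X \<subseteq> N"
  unfolding loc_span_def by blast

lemma saturated_loc_span:
  assumes "X \<subseteq> carrier M"
  shows "saturated R P M (loc_span R P M X)"
proof -
  have mem: "x \<in> loc_span R P M X \<longleftrightarrow> (\<forall>N. saturated R P M N \<longrightarrow> X \<subseteq> N \<longrightarrow> x \<in> N)" for x
    by (auto simp: loc_span_def)
  show ?thesis
  proof (rule saturatedI)
    show "loc_span R P M X \<subseteq> carrier M"
      by (rule loc_span_least[OF saturated_carrier assms])
    show "\<zero>\<^bsub>M\<^esub> \<in> loc_span R P M X"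
      by (simp add: mem saturatedD(2)[of P])
  next
    fix x y assume "x \<in> loc_span R P M X" "y \<in> loc_span R P M X"
    then show "x \<oplus>\<^bsub>M\<^esub> y \<in> loc_span R P M X"
      by (simp add: mem saturatedD(4)[of P])
  next
    fix a x assume "a \<in> carrier R" "x \<in> loc_span R P M X"
    then show "a \<odot>\<^bsub>M\<^esub> x \<in> loc_span R P M X"
      by (simp add: mem saturatedD(5)[of P])
  next
    fix u x assume u: "u \<in> carrier R - P" "x \<in> carrier M" and ux: "u \<odot>\<^bsub>M\<^esub> x \<in> loc_span R P M X"
    show "x \<in> loc_span R P M X"
      unfolding mem
    proof (intro allI impI)
      fix N assume N: "saturated R P M N" "X \<subseteq> N"
      then have "u \<odot>\<^bsub>M\<^esub> x \<in> N" using ux mem by blast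
      then show "x \<in> N" by (rule saturatedD(6)[OF N(1) u])
    qed
  qed
qed

end

locale module_at_prime = module R M + locally_field_prime P R
  for P and R (structure) and M (structure)
begin

lemma outside_mult: "u \<in> carrier R - P \<Longrightarrow> v \<in> carrier R - P \<Longrightarrow> u \<otimes> v \<in> carrier R - P"
  using I_prime by auto

lemma one_outside: "\<one> \<in> carrier R - P"
  using I_notcarr one_imp_carrier by auto

text \<open>
  The right-hand side is the preimage of the sum of a line and a subspace of \<open>M\<^sub>P\<close>; it is a
  saturated submodule, as one sees by clearing denominators.
\<close>

lemma loc_span_insert:
  assumes S: "S \<subseteq> carrier M" and y: "y \<in> carrier M"
  shows "loc_span R P M (insert y S) \<subseteq>
    {x \<in> carrier M. \<exists>u\<in>carrier R - P. \<exists>a\<in>carrier R. \<exists>z\<in>loc_span R P M S.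
       u \<odot>\<^bsub>M\<^esub> x = a \<odot>\<^bsub>M\<^esub> y \<oplus>\<^bsub>M\<^esub> z}" (is "_ \<subseteq> ?N")
proof (rule loc_span_least)
  note C = saturatedD[OF saturated_loc_span[OF S, of P]]
  let ?C = "loc_span R P M S"
  have inN: "x \<in> ?N" if "x \<in> carrier M" "u \<in> carrier R - P" "a \<in> carrier R" "z \<in> ?C"
    "u \<odot>\<^bsub>M\<^esub> x = a \<odot>\<^bsub>M\<^esub> y \<oplus>\<^bsub>M\<^esub> z" for x u a z
    using that by blast
  have "y \<in> ?N"
    by (rule inN[OF y one_outside _ C(2), of \<one>]) (use y in simp_all)
  moreover have "x \<in> ?N" if "x \<in> S" for x
    by (rule inN[OF _ one_outside, of _ \<zero> x])
      (use y that S subset_loc_span[of S P] in auto)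
  ultimately show "insert y S \<subseteq> ?N" by blast
  show "saturated R P M ?N"
  proof (rule saturatedI)
    show "\<zero>\<^bsub>M\<^esub> \<in> ?N"
      by (rule inN[OF _ one_outside _ C(2), of _ \<zero>]) (use y in simp_all)
  next
    fix x x' assume "x \<in> ?N" "x' \<in> ?N"
    then obtain u a z u' a' z' where
      h: "x \<in> carrier M" "u \<in> carrier R - P" "a \<in> carrier R" "z \<in> ?C"
        "u \<odot>\<^bsub>M\<^esub> x = a \<odot>\<^bsub>M\<^esub> y \<oplus>\<^bsub>M\<^esub> z" and
      h': "x' \<in> carrier M" "u' \<in> carrier R - P" "a' \<in> carrier R" "z' \<in> ?C"
        "u' \<odot>\<^bsub>M\<^esub> x' = a' \<odot>\<^bsub>M\<^esub> y \<oplus>\<^bsub>M\<^esub> z'" by blast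
    have zc: "z \<in> carrier M" "z' \<in> carrier M" using h(4) h'(4) C(1) by auto
    have uc: "u \<in> carrier R" "u' \<in> carrier R" using h(2) h'(2) by auto
    have "(u \<otimes> u') \<odot>\<^bsub>M\<^esub> (x \<oplus>\<^bsub>M\<^esub> x') = (u' \<otimes> u) \<odot>\<^bsub>M\<^esub> x \<oplus>\<^bsub>M\<^esub> (u \<otimes> u') \<odot>\<^bsub>M\<^esub> x'"
      using uc h(1) h'(1) by (simp add: smult_r_distr m_comm)
    also have "\<dots> = u' \<odot>\<^bsub>M\<^esub> (a \<odot>\<^bsub>M\<^esub> y \<oplus>\<^bsub>M\<^esub> z) \<oplus>\<^bsub>M\<^esub> u \<odot>\<^bsub>M\<^esub> (a' \<odot>\<^bsub>M\<^esub> y \<oplus>\<^bsub>M\<^esub> z')"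
      using uc h(1,5) h'(1,5) by (simp add: smult_assoc1)
    also have "\<dots> = (u' \<otimes> a \<oplus> u \<otimes> a') \<odot>\<^bsub>M\<^esub> y \<oplus>\<^bsub>M\<^esub> (u' \<odot>\<^bsub>M\<^esub> z \<oplus>\<^bsub>M\<^esub> u \<odot>\<^bsub>M\<^esub> z')"
      using uc h(3) h'(3) y zc
      by (simp add: smult_r_distr smult_l_distr smult_assoc1 M.a_ac)
    finally have eq: "(u \<otimes> u') \<odot>\<^bsub>M\<^esub> (x \<oplus>\<^bsub>M\<^esub> x') =
      (u' \<otimes> a \<oplus> u \<otimes> a') \<odot>\<^bsub>M\<^esub> y \<oplus>\<^bsub>M\<^esub> (u' \<odot>\<^bsub>M\<^esub> z \<oplus>\<^bsub>M\<^esub> u \<odot>\<^bsub>M\<^esub> z')" .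
    show "x \<oplus>\<^bsub>M\<^esub> x' \<in> ?N"
      by (rule inN[OF _ outside_mult[OF h(2) h'(2)] _
            C(4)[OF C(5)[OF uc(2) h(4)] C(5)[OF uc(1) h'(4)]] eq])
        (use uc h(1,3) h'(1,3) in simp_all)
  next
    fix b x assume b: "b \<in> carrier R" and "x \<in> ?N"
    then obtain u a z where
      h: "x \<in> carrier M" "u \<in> carrier R - P" "a \<in> carrier R" "z \<in> ?C"
        "u \<odot>\<^bsub>M\<^esub> x = a \<odot>\<^bsub>M\<^esub> y \<oplus>\<^bsub>M\<^esub> z" by blast
    have zc: "z \<in> carrier M" using h(4) C(1) by auto
    have uc: "u \<in> carrier R" using h(2) by auto
    have "u \<odot>\<^bsub>M\<^esub> (b \<odot>\<^bsub>M\<^esub> x) = b \<odot>\<^bsub>M\<^esub> (u \<odot>\<^bsub>M\<^esub> x)"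
      using uc b h(1) by (simp add: smult_assoc1[symmetric] m_comm)
    also have "\<dots> = (b \<otimes> a) \<odot>\<^bsub>M\<^esub> y \<oplus>\<^bsub>M\<^esub> b \<odot>\<^bsub>M\<^esub> z"
      unfolding h(5) using b h(3) y zc by (simp add: smult_r_distr smult_assoc1)
    finally have eq: "u \<odot>\<^bsub>M\<^esub> (b \<odot>\<^bsub>M\<^esub> x) = (b \<otimes> a) \<odot>\<^bsub>M\<^esub> y \<oplus>\<^bsub>M\<^esub> b \<odot>\<^bsub>M\<^esub> z" .
    show "b \<odot>\<^bsub>M\<^esub> x \<in> ?N"
      by (rule inN[OF _ h(2) _ C(5)[OF b h(4)] eq]) (use b h(1,3) in simp_all)
  next
    fix v x assume v: "v \<in> carrier R - P" and x: "x \<in> carrier M" and "v \<odot>\<^bsub>M\<^esub> x \<in> ?N"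
    then obtain u a z where
      h: "u \<in> carrier R - P" "a \<in> carrier R" "z \<in> ?C"
        "u \<odot>\<^bsub>M\<^esub> (v \<odot>\<^bsub>M\<^esub> x) = a \<odot>\<^bsub>M\<^esub> y \<oplus>\<^bsub>M\<^esub> z" by blast
    have "(u \<otimes> v) \<odot>\<^bsub>M\<^esub> x = a \<odot>\<^bsub>M\<^esub> y \<oplus>\<^bsub>M\<^esub> z"
      using h v x by (simp add: smult_assoc1)
    then show "x \<in> ?N"
      by (rule inN[OF x outside_mult[OF h(1) v] h(2,3)])
  qed blast
qed

text \<open>
  Exchange holds because \<open>R\<^sub>P\<close> is a field. If \<open>u x = a y + z\<close> with \<open>z\<close> in the span of
  \<open>S\<close>, then \<open>a \<in> P\<close> would let some \<open>w \<notin> P\<close> kill \<open>a\<close> and put \<open>x\<close> into the span of \<open>S\<close>; so \<open>a\<close> is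
  invertible in \<open>R\<^sub>P\<close> and the equation can be solved for \<open>y\<close>.
\<close>

lemma pregeometry_loc_span: "pregeometry (carrier M) (loc_span R P M)"
proof
  show "X \<subseteq> loc_span R P M X" for X by (rule subset_loc_span)
  show "loc_span R P M X \<subseteq> loc_span R P M Y"
    if "Y \<subseteq> carrier M" "X \<subseteq> loc_span R P M Y" for X Y
    using loc_span_least[OF saturated_loc_span] that by blast
next
  fix S x y
  assume S: "S \<subseteq> carrier M" and x: "x \<in> carrier M" and y: "y \<in> carrier M"
    and xin: "x \<in> loc_span R P M (insert y S)" and xn: "x \<notin> loc_span R P M S"
  let ?D = "loc_span R P M (insert x S)"
  note C = saturatedD[OF saturated_loc_span[OF S, of P]]
  have "insert x S \<subseteq> carrier M" using x S by blast
  note D = saturatedD[OF saturated_loc_span[OF this, of P]]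
  obtain u a z where h: "u \<in> carrier R - P" "a \<in> carrier R" "z \<in> loc_span R P M S"
    "u \<odot>\<^bsub>M\<^esub> x = a \<odot>\<^bsub>M\<^esub> y \<oplus>\<^bsub>M\<^esub> z"
    using xin loc_span_insert[OF S y] by blast
  have zc: "z \<in> carrier M" using h(3) C(1) by blast
  have aP: "a \<notin> P"
  proof
    assume "a \<in> P"
    then obtain w where w: "w \<in> carrier R - P" "w \<otimes> a = \<zero>" using killed_outside by blast
    have "w \<odot>\<^bsub>M\<^esub> (u \<odot>\<^bsub>M\<^esub> x) = (w \<otimes> a) \<odot>\<^bsub>M\<^esub> y \<oplus>\<^bsub>M\<^esub> w \<odot>\<^bsub>M\<^esub> z"
      unfolding h(4) using w(1) h(2) y zc by (simp add: smult_r_distr smult_assoc1)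
    also have "\<dots> = w \<odot>\<^bsub>M\<^esub> z" using w y zc by simp
    finally have "(w \<otimes> u) \<odot>\<^bsub>M\<^esub> x \<in> loc_span R P M S"
      using C(5)[of w, OF _ h(3)] w(1) h(1) x by (simp add: smult_assoc1)
    then show False using C(6) outside_mult[OF w(1) h(1)] x xn by blast
  qed
  have xD: "x \<in> ?D" and SD: "S \<subseteq> ?D" using subset_loc_span[of "insert x S" P] by auto
  have "loc_span R P M S \<subseteq> ?D"
    by (rule loc_span_least[OF saturated_loc_span SD]) (use x S in auto)
  then have "z \<in> ?D" using h(3) by blast
  moreover have "u \<odot>\<^bsub>M\<^esub> x \<in> ?D" using D(5)[OF _ xD] h(1) by blast
  ultimately have "u \<odot>\<^bsub>M\<^esub> x \<oplus>\<^bsub>M\<^esub> \<ominus>\<^bsub>M\<^esub> z \<in> ?D" using D(3,4) by blast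
  moreover have "u \<odot>\<^bsub>M\<^esub> x \<oplus>\<^bsub>M\<^esub> \<ominus>\<^bsub>M\<^esub> z = a \<odot>\<^bsub>M\<^esub> y"
    unfolding h(4) using h(2) y zc by (simp add: M.a_assoc M.r_neg)
  ultimately have "a \<odot>\<^bsub>M\<^esub> y \<in> ?D" by simp
  then show "y \<in> ?D" using D(6)[OF _ y] h(2) aP by simp
qed

end


section \<open>Rank and nullity of a homomorphism\<close>

locale module_hom_at_prime =
  M: module_at_prime P R M + N: module_at_prime P R N
  for P and R (structure) and M and N +
  fixes h
  assumes h: "h \<in> mod_hom R M N"
begin

lemma h_closed: "x \<in> carrier M \<Longrightarrow> h x \<in> carrier N"
  using h by (auto simp: mod_hom_def hom_def)

lemma h_add: "x \<in> carrier M \<Longrightarrow> y \<in> carrier M \<Longrightarrow> h (x \<oplus>\<^bsub>M\<^esub> y) = h x \<oplus>\<^bsub>N\<^esub> h y"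
  using h by (auto simp: mod_hom_def hom_def)

lemma h_smult: "a \<in> carrier R \<Longrightarrow> x \<in> carrier M \<Longrightarrow> h (a \<odot>\<^bsub>M\<^esub> x) = a \<odot>\<^bsub>N\<^esub> h x"
  using h by (auto simp: mod_hom_def)

lemma h_zero: "h \<zero>\<^bsub>M\<^esub> = \<zero>\<^bsub>N\<^esub>"
  using h_smult[of \<zero> "\<zero>\<^bsub>M\<^esub>"] h_closed[of "\<zero>\<^bsub>M\<^esub>"] by simp

lemma h_minus: "x \<in> carrier M \<Longrightarrow> h (\<ominus>\<^bsub>M\<^esub> x) = \<ominus>\<^bsub>N\<^esub> h x"
  using h_smult[of "\<ominus> \<one>" x] M.smult_l_minus[of \<one> x] N.smult_l_minus[of \<one> "h x"] h_closed[of x]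
  by simp

lemma image_loc_span:
  assumes X: "X \<subseteq> carrier M"
  shows "h ` loc_span R P M X \<subseteq> loc_span R P N (h ` X)"
proof -
  let ?K = "loc_span R P N (h ` X)"
  have hX: "h ` X \<subseteq> carrier N" using X h_closed by blast
  note K = N.saturatedD[OF N.saturated_loc_span[OF hX, of P]]
  have "saturated R P M {x \<in> carrier M. h x \<in> ?K}"
    by (rule M.saturatedI) (auto simp: h_zero h_add h_smult h_closed K(2,4,5) intro: K(6))
  then have "loc_span R P M X \<subseteq> {x \<in> carrier M. h x \<in> ?K}"
    by (rule M.loc_span_least) (use X N.subset_loc_span[of "h ` X" P] in auto)
  then show ?thesis by blast
qed

text \<open>
  The image of a saturated submodule is in general not saturated, so that a denominator \<open>u\<close> is
  needed.
\<close>

lemma lift_loc_span: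
  assumes G: "G \<subseteq> carrier M" and y: "y \<in> loc_span R P N (h ` G)"
  shows "\<exists>u\<in>carrier R - P. \<exists>z\<in>loc_span R P M G. u \<odot>\<^bsub>N\<^esub> y = h z"
proof -
  let ?C = "loc_span R P M G"
  let ?K = "{y \<in> carrier N. \<exists>u\<in>carrier R - P. \<exists>z\<in>?C. u \<odot>\<^bsub>N\<^esub> y = h z}"
  note C = M.saturatedD[OF M.saturated_loc_span[OF G, of P]]
  have inK: "y \<in> ?K" if "y \<in> carrier N" "u \<in> carrier R - P" "z \<in> ?C" "u \<odot>\<^bsub>N\<^esub> y = h z" for y u z
    using that by blast
  have "saturated R P N ?K"
  proof (rule N.saturatedI)
    show "\<zero>\<^bsub>N\<^esub> \<in> ?K"
      by (rule inK[OF _ M.one_outside C(2)]) (simp_all add: h_zero)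
  next
    fix y y' assume "y \<in> ?K" "y' \<in> ?K"
    then obtain u z u' z' where
      k: "y \<in> carrier N" "u \<in> carrier R - P" "z \<in> ?C" "u \<odot>\<^bsub>N\<^esub> y = h z" and
      k': "y' \<in> carrier N" "u' \<in> carrier R - P" "z' \<in> ?C" "u' \<odot>\<^bsub>N\<^esub> y' = h z'"
      by blast
    have uc: "u \<in> carrier R" "u' \<in> carrier R" using k(2) k'(2) by auto
    have zc: "z \<in> carrier M" "z' \<in> carrier M" using k(3) k'(3) C(1) by auto
    have "(u \<otimes> u') \<odot>\<^bsub>N\<^esub> (y \<oplus>\<^bsub>N\<^esub> y') = (u' \<otimes> u) \<odot>\<^bsub>N\<^esub> y \<oplus>\<^bsub>N\<^esub> (u \<otimes> u') \<odot>\<^bsub>N\<^esub> y'"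
      using uc k(1) k'(1) by (simp add: N.smult_r_distr M.R.m_comm)
    also have "\<dots> = u' \<odot>\<^bsub>N\<^esub> h z \<oplus>\<^bsub>N\<^esub> u \<odot>\<^bsub>N\<^esub> h z'"
      using uc k(1,4) k'(1,4) by (simp add: N.smult_assoc1)
    also have "\<dots> = h (u' \<odot>\<^bsub>M\<^esub> z \<oplus>\<^bsub>M\<^esub> u \<odot>\<^bsub>M\<^esub> z')"
      using uc zc by (simp add: h_add h_smult)
    finally have eq: "(u \<otimes> u') \<odot>\<^bsub>N\<^esub> (y \<oplus>\<^bsub>N\<^esub> y') = h (u' \<odot>\<^bsub>M\<^esub> z \<oplus>\<^bsub>M\<^esub> u \<odot>\<^bsub>M\<^esub> z')" .
    show "y \<oplus>\<^bsub>N\<^esub> y' \<in> ?K"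
      by (rule inK[OF _ M.outside_mult[OF k(2) k'(2)]
            C(4)[OF C(5)[OF uc(2) k(3)] C(5)[OF uc(1) k'(3)]] eq])
        (use k(1) k'(1) in simp)
  next
    fix b y assume b: "b \<in> carrier R" and "y \<in> ?K"
    then obtain u z where
      k: "y \<in> carrier N" "u \<in> carrier R - P" "z \<in> ?C" "u \<odot>\<^bsub>N\<^esub> y = h z" by blast
    have zc: "z \<in> carrier M" using k(3) C(1) by auto
    have "u \<odot>\<^bsub>N\<^esub> (b \<odot>\<^bsub>N\<^esub> y) = b \<odot>\<^bsub>N\<^esub> (u \<odot>\<^bsub>N\<^esub> y)"
      using b k(1,2) by (simp add: N.smult_assoc1[symmetric] M.R.m_comm)
    also have "\<dots> = h (b \<odot>\<^bsub>M\<^esub> z)" using k(4) b zc by (simp add: h_smult)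
    finally have eq: "u \<odot>\<^bsub>N\<^esub> (b \<odot>\<^bsub>N\<^esub> y) = h (b \<odot>\<^bsub>M\<^esub> z)" .
    show "b \<odot>\<^bsub>N\<^esub> y \<in> ?K"
      by (rule inK[OF _ k(2) C(5)[OF b k(3)] eq]) (use b k(1) in simp)
  next
    fix v y assume v: "v \<in> carrier R - P" and y: "y \<in> carrier N" and "v \<odot>\<^bsub>N\<^esub> y \<in> ?K"
    then obtain u z where k: "u \<in> carrier R - P" "z \<in> ?C" "u \<odot>\<^bsub>N\<^esub> (v \<odot>\<^bsub>N\<^esub> y) = h z" by blast
    have "(u \<otimes> v) \<odot>\<^bsub>N\<^esub> y = h z" using k v y by (simp add: N.smult_assoc1)
    then show "y \<in> ?K"
      by (rule inK[OF y M.outside_mult[OF k(1) v] k(2)])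
  qed blast
  moreover have "h ` G \<subseteq> ?K"
  proof
    fix y assume "y \<in> h ` G"
    then obtain x where x: "x \<in> G" "y = h x" by blast
    show "y \<in> ?K"
      by (rule inK[OF _ M.one_outside, of _ x])
        (use x G h_closed M.subset_loc_span[of G P] in auto)
  qed
  ultimately have "loc_span R P N (h ` G) \<subseteq> ?K" by (rule N.loc_span_least)
  then show ?thesis using y by blast
qed

text \<open>
  Additivity of the rank, where \<open>Y\<close> agrees with the kernel of \<open>h\<close> after localization. Preimages
  of a basis of the image are added one at a time to a basis of \<open>Y\<close>; independence survives each
  step since \<open>h\<close> maps the span of the earlier vectors into the span of the earlier members of the
  basis of the image.
\<close>

lemma basis_of_kernel_and_image:
  assumes Y: "Y \<subseteq> carrier M" "h ` Y \<subseteq> {\<zero>\<^bsub>N\<^esub>}"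
    and ker: "\<And>x. x \<in> carrier M \<Longrightarrow> h x = \<zero>\<^bsub>N\<^esub> \<Longrightarrow> \<exists>u\<in>carrier R - P. u \<odot>\<^bsub>M\<^esub> x \<in> Y"
    and S: "basis_of (loc_span R P M) Y S"
    and T: "basis_of (loc_span R P N) (h ` carrier M) T"
  shows "\<exists>B. basis_of (loc_span R P M) (carrier M) B \<and> card B = card S + card T"
proof -
  interpret PM: pregeometry "carrier M" "loc_span R P M" by (rule M.pregeometry_loc_span)
  interpret PN: pregeometry "carrier N" "loc_span R P N" by (rule N.pregeometry_loc_span)
  define g where "g = inv_into (carrier M) h"
  have S': "S \<subseteq> Y" "finite S" "independent_in (loc_span R P M) S" "Y \<subseteq> loc_span R P M S"
    using S by (auto simp: basis_of_def)
  have T': "T \<subseteq> h ` carrier M" "finite T" "independent_in (loc_span R P N) T"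
      "h ` carrier M \<subseteq> loc_span R P N T"
    using T by (auto simp: basis_of_def)
  have gM: "g t \<in> carrier M" and hg: "h (g t) = t" if "t \<in> T" for t
    using that T'(1) by (auto simp: g_def inv_into_into f_inv_into_f subset_iff)
  have TN: "T \<subseteq> carrier N" using T'(1) h_closed by blast
  have SM: "S \<subseteq> carrier M" using S'(1) Y(1) by blast
  have step: "independent_in (loc_span R P M) (S \<union> g ` T0) \<and> card (S \<union> g ` T0) = card S + card T0"
    if "finite T0" "T0 \<subseteq> T" for T0
    using that
  proof (induction T0)
    case empty
    then show ?case using S' by simp
  next
    case (insert t T0)
    let ?B = "S \<union> g ` T0"
    have T0N: "T0 \<subseteq> carrier N" and t: "t \<in> T" and T0T: "T0 \<subseteq> T" using insert.prems TN by auto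
    have BM: "?B \<subseteq> carrier M" using SM gM T0T by blast
    have "g t \<notin> loc_span R P M ?B"
    proof
      assume "g t \<in> loc_span R P M ?B"
      then have "h (g t) \<in> loc_span R P N (h ` ?B)" using image_loc_span[OF BM] by blast
      moreover have "loc_span R P N (h ` ?B) \<subseteq> loc_span R P N T0"
      proof (rule N.loc_span_least[OF N.saturated_loc_span[OF T0N]])
        have z: "\<zero>\<^bsub>N\<^esub> \<in> loc_span R P N T0"
          by (rule N.saturatedD(2)[OF N.saturated_loc_span[OF T0N]])
        have "h s = \<zero>\<^bsub>N\<^esub>" if "s \<in> S" for s
          using Y(2) S'(1) that by auto
        then have "h ` S \<subseteq> loc_span R P N T0" using z by auto
        moreover have "h (g t') \<in> loc_span R P N T0" if "t' \<in> T0" for t'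
          unfolding hg[OF subsetD[OF T0T that]] by (rule subsetD[OF N.subset_loc_span that])
        ultimately show "h ` ?B \<subseteq> loc_span R P N T0" by auto
      qed
      moreover have "loc_span R P N T0 \<subseteq> loc_span R P N (T - {t})"
        by (rule PN.cl_mono) (use insert.hyps T0T TN in auto)
      ultimately have "t \<in> loc_span R P N (T - {t})" using hg[OF t] by auto
      then show False using T'(3) t by (auto simp: independent_in_def)
    qed
    then have gt: "g t \<notin> ?B" "independent_in (loc_span R P M) (insert (g t) ?B)"
      using M.subset_loc_span[of ?B P] PM.independent_insert[OF BM gM[OF t]] insert.IH[OF T0T]
      by (blast, simp)
    moreover have "S \<union> g ` insert t T0 = insert (g t) ?B" by simp
    moreover have "card (insert (g t) ?B) = Suc (card ?B)"
      using gt(1) S'(2) insert.hyps(1) by (intro card_insert_disjoint) auto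
    ultimately show ?case
      using insert.IH[OF T0T] insert.hyps by simp
  qed
  let ?B = "S \<union> g ` T"
  have BM: "?B \<subseteq> carrier M" using SM gM by blast
  note D = M.saturatedD[OF M.saturated_loc_span[OF BM, of P]]
  have "carrier M \<subseteq> loc_span R P M ?B"
  proof
    fix v assume v: "v \<in> carrier M"
    have gTM: "g ` T \<subseteq> carrier M" using gM by blast
    have hgT: "h ` g ` T = T" using hg by (force simp: image_iff)
    have "h v \<in> loc_span R P N (h ` g ` T)" using T'(4) v hgT by auto
    then obtain u z where uz: "u \<in> carrier R - P" "z \<in> loc_span R P M (g ` T)" "u \<odot>\<^bsub>N\<^esub> h v = h z"
      using lift_loc_span[OF gTM] by blast
    have zB: "z \<in> loc_span R P M ?B" using uz(2) PM.cl_mono[of "g ` T" ?B] BM by blast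
    have zM: "z \<in> carrier M" using zB D(1) by blast
    let ?w = "u \<odot>\<^bsub>M\<^esub> v \<oplus>\<^bsub>M\<^esub> \<ominus>\<^bsub>M\<^esub> z"
    have wM: "?w \<in> carrier M" using uz(1) v zM by simp
    have "h ?w = \<zero>\<^bsub>N\<^esub>"
      using uz(1,3) v zM h_closed[OF zM] by (simp add: h_add h_smult h_minus N.M.r_neg)
    then obtain w where w: "w \<in> carrier R - P" "w \<odot>\<^bsub>M\<^esub> ?w \<in> Y" using ker[OF wM] by blast
    have "Y \<subseteq> loc_span R P M ?B" using S'(4) PM.cl_mono[of S ?B] BM by blast
    then have "?w \<in> loc_span R P M ?B" using D(6)[OF w(1) wM] w(2) by (metis subsetD)
    then have "?w \<oplus>\<^bsub>M\<^esub> z \<in> loc_span R P M ?B" by (rule D(4)[OF _ zB])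
    moreover have "?w \<oplus>\<^bsub>M\<^esub> z = u \<odot>\<^bsub>M\<^esub> v"
      using uz(1) v zM by (simp add: M.M.a_assoc M.M.l_neg)
    ultimately show "v \<in> loc_span R P M ?B" using D(6)[OF uz(1) v] by simp
  qed
  then have "basis_of (loc_span R P M) (carrier M) ?B"
    using step[OF T'(2)] BM S'(2) T'(2) by (simp add: basis_of_def)
  then show ?thesis using step[OF T'(2)] by blast
qed

end


section \<open>Ranks in a free resolution\<close>

lemma (in module_at_prime) killed_in_saturated:
  assumes "saturated R P M N" "x \<in> carrier M" "u \<in> carrier R - P" "u \<odot>\<^bsub>M\<^esub> x = \<zero>\<^bsub>M\<^esub>"
  shows "x \<in> N"
  using saturatedD(6)[OF assms(1,3,2)] saturatedD(2)[OF assms(1)] assms(4) by simp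

lemma (in module_at_prime) loc_span_empty:
  "loc_span R P M {} = {x \<in> carrier M. \<exists>u\<in>carrier R - P. u \<odot>\<^bsub>M\<^esub> x = \<zero>\<^bsub>M\<^esub>}" (is "_ = ?T")
proof
  have inT: "x \<in> ?T" if "x \<in> carrier M" "u \<in> carrier R - P" "u \<odot>\<^bsub>M\<^esub> x = \<zero>\<^bsub>M\<^esub>" for x u
    using that by blast
  have "saturated R P M ?T"
  proof (rule saturatedI)
    show "\<zero>\<^bsub>M\<^esub> \<in> ?T" by (rule inT[OF _ one_outside]) simp_all
  next
    fix x y assume "x \<in> ?T" "y \<in> ?T"
    then obtain u v where u: "x \<in> carrier M" "u \<in> carrier R - P" "u \<odot>\<^bsub>M\<^esub> x = \<zero>\<^bsub>M\<^esub>"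
      and v: "y \<in> carrier M" "v \<in> carrier R - P" "v \<odot>\<^bsub>M\<^esub> y = \<zero>\<^bsub>M\<^esub>" by blast
    have uc: "u \<in> carrier R" "v \<in> carrier R" using u v by auto
    have "(u \<otimes> v) \<odot>\<^bsub>M\<^esub> (x \<oplus>\<^bsub>M\<^esub> y) = (v \<otimes> u) \<odot>\<^bsub>M\<^esub> x \<oplus>\<^bsub>M\<^esub> (u \<otimes> v) \<odot>\<^bsub>M\<^esub> y"
      using uc u(1) v(1) by (simp add: smult_r_distr m_comm)
    also have "\<dots> = \<zero>\<^bsub>M\<^esub>" using uc u(1,3) v(1,3) by (simp add: smult_assoc1)
    finally have eq: "(u \<otimes> v) \<odot>\<^bsub>M\<^esub> (x \<oplus>\<^bsub>M\<^esub> y) = \<zero>\<^bsub>M\<^esub>" .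
    show "x \<oplus>\<^bsub>M\<^esub> y \<in> ?T"
      by (rule inT[OF _ outside_mult[OF u(2) v(2)] eq]) (use u(1) v(1) in simp)
  next
    fix a x assume a: "a \<in> carrier R" and "x \<in> ?T"
    then obtain u where u: "x \<in> carrier M" "u \<in> carrier R - P" "u \<odot>\<^bsub>M\<^esub> x = \<zero>\<^bsub>M\<^esub>" by blast
    have uc: "u \<in> carrier R" using u by auto
    have "u \<odot>\<^bsub>M\<^esub> (a \<odot>\<^bsub>M\<^esub> x) = a \<odot>\<^bsub>M\<^esub> (u \<odot>\<^bsub>M\<^esub> x)"
      using uc a u(1) by (simp add: smult_assoc1[symmetric] m_comm)
    also have "\<dots> = \<zero>\<^bsub>M\<^esub>" using u(3) a by simp
    finally have eq: "u \<odot>\<^bsub>M\<^esub> (a \<odot>\<^bsub>M\<^esub> x) = \<zero>\<^bsub>M\<^esub>" .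
    show "a \<odot>\<^bsub>M\<^esub> x \<in> ?T"
      by (rule inT[OF _ u(2) eq]) (use a u(1) in simp)
  next
    fix v x assume v: "v \<in> carrier R - P" and x: "x \<in> carrier M" and "v \<odot>\<^bsub>M\<^esub> x \<in> ?T"
    then obtain u where u: "u \<in> carrier R - P" "u \<odot>\<^bsub>M\<^esub> (v \<odot>\<^bsub>M\<^esub> x) = \<zero>\<^bsub>M\<^esub>" by blast
    have "(u \<otimes> v) \<odot>\<^bsub>M\<^esub> x = \<zero>\<^bsub>M\<^esub>" using u v x by (simp add: smult_assoc1)
    then show "x \<in> ?T" by (rule inT[OF x outside_mult[OF u(1) v]])
  qed blast
  then show "loc_span R P M {} \<subseteq> ?T" by (rule loc_span_least) simp
  show "?T \<subseteq> loc_span R P M {}"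
    using killed_in_saturated[OF saturated_loc_span[of "{}"]] by blast
qed

text \<open>
  Rank zero means that the image of \<open>Y\<close> in \<open>M\<^sub>P\<close> vanishes.
\<close>

lemma (in module_at_prime) empty_basis_iff:
  assumes S: "basis_of (loc_span R P M) Y S" and Y: "Y \<subseteq> carrier M"
  shows "card S = 0 \<longleftrightarrow> (\<forall>y\<in>Y. \<exists>u\<in>carrier R - P. u \<odot>\<^bsub>M\<^esub> y = \<zero>\<^bsub>M\<^esub>)"
proof
  assume "card S = 0"
  then have "S = {}" using S by (simp add: basis_of_def)
  then have "Y \<subseteq> loc_span R P M {}" using S by (simp add: basis_of_def)
  then show "\<forall>y\<in>Y. \<exists>u\<in>carrier R - P. u \<odot>\<^bsub>M\<^esub> y = \<zero>\<^bsub>M\<^esub>"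
    unfolding loc_span_empty by blast
next
  assume killed: "\<forall>y\<in>Y. \<exists>u\<in>carrier R - P. u \<odot>\<^bsub>M\<^esub> y = \<zero>\<^bsub>M\<^esub>"
  have SM: "S \<subseteq> carrier M" "S \<subseteq> Y" using S Y by (auto simp: basis_of_def)
  have "s \<in> loc_span R P M (S - {s})" if s: "s \<in> S" for s
  proof -
    obtain u where "u \<in> carrier R - P" "u \<odot>\<^bsub>M\<^esub> s = \<zero>\<^bsub>M\<^esub>" using killed s SM(2) by blast
    then show ?thesis
      by (intro killed_in_saturated[OF saturated_loc_span]) (use s SM(1) in auto)
  qed
  then have "S = {}" using S by (auto simp: basis_of_def independent_in_def)
  then show "card S = 0" by simp
qed

lemma free_module_simps:
  "\<zero>\<^bsub>free_module R B\<^esub> = (\<lambda>_. \<zero>\<^bsub>R\<^esub>)"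
  "u \<oplus>\<^bsub>free_module R B\<^esub> v = (\<lambda>b. u b \<oplus>\<^bsub>R\<^esub> v b)"
  "a \<odot>\<^bsub>free_module R B\<^esub> v = (\<lambda>b. a \<otimes>\<^bsub>R\<^esub> v b)"
  by (simp_all add: free_module_def)

lemma free_module_carrier_iff:
  "v \<in> carrier (free_module R {..<n::nat}) \<longleftrightarrow>
     (\<forall>b. v b \<in> carrier R) \<and> (\<forall>b\<ge>n. v b = \<zero>\<^bsub>R\<^esub>)"
proof -
  have "finite {b. v b \<noteq> \<zero>\<^bsub>R\<^esub>}" if "\<forall>b\<ge>n. v b = \<zero>\<^bsub>R\<^esub>"
    by (rule finite_subset[of _ "{..<n}"]) (use that linorder_not_less in auto)
  then show ?thesis by (auto simp: free_module_def not_less)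
qed

text \<open>
  The unit vectors form a basis. A unit vector is not in the span of the others, since the vectors
  whose coordinate at \<open>b\<close> lies in \<open>P\<close> form a saturated submodule.
\<close>

lemma (in locally_field_prime) basis_of_free_module:
  assumes "module R (free_module R {..<n::nat})"
  shows "\<exists>B. basis_of (loc_span R P (free_module R {..<n})) (carrier (free_module R {..<n})) B
    \<and> card B = n"
proof -
  let ?F = "free_module R {..<n}"
  interpret F: module_at_prime P R ?F
    using assms locally_field_prime_axioms by (simp add: module_at_prime_def)
  define e where "e b = (\<lambda>k. if k = b then \<one> else \<zero>)" for b :: nat
  have one_zero: "\<one> \<noteq> \<zero>" using F.one_outside F.zero_closed by auto
  have e: "e b \<in> carrier ?F" if "b < n" for b
    using that by (auto simp: free_module_carrier_iff e_def)
  have inj: "inj_on e {..<n}"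
    using one_zero by (auto simp: inj_on_def e_def fun_eq_iff)
  let ?B = "e ` {..<n}"
  have BF: "?B \<subseteq> carrier ?F" using e by blast
  note D = F.saturatedD[OF F.saturated_loc_span[OF BF, of P]]
  \<comment> \<open>induction on the number of leading coordinates that may be nonzero\<close>
  have low: "v \<in> loc_span R P ?F ?B"
    if "v \<in> carrier ?F" "m \<le> n" "\<And>k. k \<ge> m \<Longrightarrow> v k = \<zero>" for m v
    using that
  proof (induction m arbitrary: v)
    case 0
    then have "v = \<zero>\<^bsub>?F\<^esub>" by (simp add: free_module_simps fun_eq_iff)
    then show ?case using D(2) by simp
  next
    case (Suc m)
    have vc: "\<And>k. v k \<in> carrier R" and vz: "\<And>k. k \<ge> n \<Longrightarrow> v k = \<zero>"
      using Suc.prems(1) by (auto simp: free_module_carrier_iff)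
    have w: "v(m := \<zero>) \<in> loc_span R P ?F ?B"
    proof (rule Suc.IH)
      show "v(m := \<zero>) \<in> carrier ?F" using vc vz by (simp add: free_module_carrier_iff)
      show "m \<le> n" using Suc.prems(2) by simp
      show "(v(m := \<zero>)) k = \<zero>" if "k \<ge> m" for k
        using Suc.prems(3)[of k] that by (cases "k = m") auto
    qed
    have "e m \<in> loc_span R P ?F ?B"
      by (rule subsetD[OF F.subset_loc_span]) (use Suc.prems(2) in auto)
    then have "v(m := \<zero>) \<oplus>\<^bsub>?F\<^esub> (v m \<odot>\<^bsub>?F\<^esub> e m) \<in> loc_span R P ?F ?B"
      by (intro D(4)[OF w] D(5)) (use vc in simp_all)
    moreover have "v(m := \<zero>) \<oplus>\<^bsub>?F\<^esub> (v m \<odot>\<^bsub>?F\<^esub> e m) = v"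
      using vc by (auto simp: free_module_simps e_def fun_eq_iff)
    ultimately show ?case by simp
  qed
  have span: "carrier ?F \<subseteq> loc_span R P ?F ?B"
  proof
    fix v assume v: "v \<in> carrier ?F"
    show "v \<in> loc_span R P ?F ?B"
      by (rule low[OF v order_refl]) (use v in \<open>simp add: free_module_carrier_iff\<close>)
  qed
  have "e b \<notin> loc_span R P ?F (?B - {e b})" if b: "b < n" for b
  proof
    let ?N = "{v \<in> carrier ?F. v b \<in> P}"
    assume "e b \<in> loc_span R P ?F (?B - {e b})"
    moreover have "saturated R P ?F ?N"
    proof (rule F.saturatedI)
      show "\<zero>\<^bsub>?F\<^esub> \<in> ?N" using F.M.zero_closed by (simp add: free_module_simps(1))
    next
      fix x y assume "x \<in> ?N" "y \<in> ?N"
      then show "x \<oplus>\<^bsub>?F\<^esub> y \<in> ?N"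
        using F.M.a_closed[of x y] by (simp add: free_module_simps)
    next
      fix a x assume "a \<in> carrier R" "x \<in> ?N"
      then show "a \<odot>\<^bsub>?F\<^esub> x \<in> ?N"
        using F.smult_closed[of a x] by (simp add: free_module_simps I_l_closed)
    next
      fix u x assume "u \<in> carrier R - P" "x \<in> carrier ?F" "u \<odot>\<^bsub>?F\<^esub> x \<in> ?N"
      then show "x \<in> ?N"
        using I_prime[of u "x b"] by (auto simp: free_module_simps free_module_carrier_iff)
    qed blast
    moreover have "?B - {e b} \<subseteq> ?N"
      using e by (auto simp: e_def)
    ultimately have "e b \<in> ?N" using F.loc_span_least by blast
    then show False using F.one_outside by (simp add: e_def)
  qed
  then have "independent_in (loc_span R P ?F) ?B" by (auto simp: independent_in_def)
  then have "basis_of (loc_span R P ?F) (carrier ?F) ?B"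
    using BF span by (simp add: basis_of_def)
  then show ?thesis using card_image[OF inj] by auto
qed

text \<open>
  This is \<open>\<beta> i - \<beta> (i - 1) + \<dots> \<plusminus> \<beta> 0\<close>, the rank of the image of
  \<open>f (i + 1)\<close> at every prime where \<open>M\<close> vanishes and the localization of \<open>R\<close> is a field; the
  subtraction does not truncate if there is such a prime. As a function of the numbers \<open>\<beta> i\<close>
  alone it is the same for all those primes.
\<close>

primrec alternating_rank :: "(nat \<Rightarrow> nat) \<Rightarrow> nat \<Rightarrow> nat" where
  "alternating_rank \<beta> 0 = \<beta> 0"
| "alternating_rank \<beta> (Suc i) = \<beta> (Suc i) - alternating_rank \<beta> i"

text \<open>
  Since \<open>M\<^sub>P = 0\<close>, the localized resolution is an exact sequence of vector spaces ending in
  \<open>F\<^sub>0 \<rightarrow> 0\<close>, so that the ranks of the images are determined from right to left by additivity.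
\<close>

lemma (in locally_field_prime) rank_of_boundaries:
  assumes res: "resolution R M (\<lambda>i. free_module R {..<\<beta> i}) f \<epsilon>"
    and M: "\<And>x. x \<in> carrier M \<Longrightarrow> \<exists>u\<in>carrier R - P. u \<odot>\<^bsub>M\<^esub> x = \<zero>\<^bsub>M\<^esub>"
  shows "\<exists>S. basis_of (loc_span R P (free_module R {..<\<beta> i}))
      (f (Suc i) ` carrier (free_module R {..<\<beta> (Suc i)})) S \<and> card S = alternating_rank \<beta> i"
proof -
  let ?F = "\<lambda>i. free_module R {..<\<beta> i}"
  let ?cl = "\<lambda>i. loc_span R P (?F i)"
  let ?B = "\<lambda>i. f (Suc i) ` carrier (?F (Suc i))"
  have modF: "module R (?F i)" for i using res by (simp add: resolution_def)
  have modM: "module R M" using res by (simp add: resolution_def)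
  have F: "module_at_prime P R (?F i)" for i
    using modF locally_field_prime_axioms by (simp add: module_at_prime_def)
  have PG: "pregeometry (carrier (?F i)) (?cl i)" for i
    using module_at_prime.pregeometry_loc_span[OF F] .
  have hom: "f (Suc i) \<in> mod_hom R (?F (Suc i)) (?F i)" for i using res by (simp add: resolution_def)
  have BF: "?B i \<subseteq> carrier (?F i)" for i using hom[of i] by (auto simp: mod_hom_def hom_def)
  have bound: "\<exists>S. basis_of (?cl i) (?B i) S" for i
  proof -
    obtain W where W: "basis_of (?cl i) (carrier (?F i)) W" using basis_of_free_module[OF modF] by blast
    show ?thesis
      by (rule pregeometry.basis_exists[OF PG, of W]) (use W BF[of i] in \<open>auto simp: basis_of_def\<close>)
  qed
  have card_basis: "card W = \<beta> i" if W: "basis_of (?cl i) (carrier (?F i)) W" for i W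
  proof -
    obtain W' where "basis_of (?cl i) (carrier (?F i)) W'" "card W' = \<beta> i"
      using basis_of_free_module[OF modF] by blast
    then show ?thesis using pregeometry.basis_card_unique[OF PG W] by auto
  qed
  show ?thesis
  proof (induction i)
    case 0
    interpret \<epsilon>: module_hom_at_prime P R "?F 0" M \<epsilon>
      using F[of 0] modM locally_field_prime_axioms res
      by (simp add: module_hom_at_prime_def module_hom_at_prime_axioms_def module_at_prime_def
        resolution_def)
    obtain S where S: "basis_of (?cl 0) (?B 0) S" using bound by blast
    have SF: "S \<subseteq> carrier (?F 0)" using S BF[of 0] by (auto simp: basis_of_def)
    have "carrier (?F 0) \<subseteq> ?cl 0 S"
    proof
      fix x assume x: "x \<in> carrier (?F 0)"
      obtain u where u: "u \<in> carrier R - P" "u \<odot>\<^bsub>M\<^esub> \<epsilon> x = \<zero>\<^bsub>M\<^esub>"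
        using M[OF \<epsilon>.h_closed[OF x]] by blast
      then have "\<epsilon> (u \<odot>\<^bsub>?F 0\<^esub> x) = \<zero>\<^bsub>M\<^esub>" using \<epsilon>.h_smult[of u x] x by simp
      then have "u \<odot>\<^bsub>?F 0\<^esub> x \<in> a_kernel (?F 0) M \<epsilon>"
        using u x by (simp add: a_kernel_def')
      then have "u \<odot>\<^bsub>?F 0\<^esub> x \<in> ?cl 0 S" using res S by (auto simp: resolution_def basis_of_def)
      then show "x \<in> ?cl 0 S"
        using \<epsilon>.M.saturatedD(6)[OF \<epsilon>.M.saturated_loc_span[OF SF] u(1) x] by simp
    qed
    then have "basis_of (?cl 0) (carrier (?F 0)) S" using S SF by (simp add: basis_of_def)
    then show ?case using S card_basis by auto
  next
    case (Suc i)
    interpret d: module_hom_at_prime P R "?F (Suc i)" "?F i" "f (Suc i)"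
      using F hom by (simp add: module_hom_at_prime_def module_hom_at_prime_axioms_def)
    obtain T where T: "basis_of (?cl i) (?B i) T" "card T = alternating_rank \<beta> i" using Suc.IH by blast
    obtain S where S: "basis_of (?cl (Suc i)) (?B (Suc i)) S" using bound by blast
    have exact: "?B (Suc i) = a_kernel (?F (Suc i)) (?F i) (f (Suc i))"
      using res by (simp add: resolution_def)
    have "\<exists>W. basis_of (?cl (Suc i)) (carrier (?F (Suc i))) W \<and> card W = card S + card T"
    proof (rule d.basis_of_kernel_and_image[OF BF _ _ S T(1)])
      show "f (Suc i) ` ?B (Suc i) \<subseteq> {\<zero>\<^bsub>?F i\<^esub>}" unfolding exact by (auto simp: a_kernel_def')
      show "\<exists>u\<in>carrier R - P. u \<odot>\<^bsub>?F (Suc i)\<^esub> x \<in> ?B (Suc i)"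
        if "x \<in> carrier (?F (Suc i))" "f (Suc i) x = \<zero>\<^bsub>?F i\<^esub>" for x
        unfolding exact using that d.M.one_outside
        by (intro bexI[of _ \<one>]) (auto simp: a_kernel_def')
    qed
    then have "card S = \<beta> (Suc i) - card T" using card_basis by fastforce
    then show ?case using S T(2) by auto
  qed
qed

lemma (in locally_field_prime) boundaries_locally_zero_iff:
  assumes res: "resolution R M (\<lambda>i. free_module R {..<\<beta> i}) f \<epsilon>"
    and M: "\<And>x. x \<in> carrier M \<Longrightarrow> \<exists>u\<in>carrier R - P. u \<odot>\<^bsub>M\<^esub> x = \<zero>\<^bsub>M\<^esub>"
  shows "(\<forall>x\<in>carrier (free_module R {..<\<beta> (Suc i)}). \<exists>u\<in>carrier R - P.
      u \<odot>\<^bsub>free_module R {..<\<beta> i}\<^esub> f (Suc i) x = \<zero>\<^bsub>free_module R {..<\<beta> i}\<^esub>)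
    \<longleftrightarrow> alternating_rank \<beta> i = 0"
proof -
  let ?F = "\<lambda>i. free_module R {..<\<beta> i}"
  have "module R (?F i)" using res by (simp add: resolution_def)
  then interpret F: module_at_prime P R "?F i"
    using locally_field_prime_axioms by (simp add: module_at_prime_def)
  have BF: "f (Suc i) ` carrier (?F (Suc i)) \<subseteq> carrier (?F i)"
    using res by (auto simp: resolution_def mod_hom_def hom_def)
  obtain S where S: "basis_of (loc_span R P (?F i)) (f (Suc i) ` carrier (?F (Suc i))) S"
    "card S = alternating_rank \<beta> i"
    using rank_of_boundaries[OF res M, of i] by blast
  show ?thesis using F.empty_basis_iff[OF S(1) BF] unfolding S(2) by blast
qed


section \<open>Vanishing of modules of finite length at minimal primes\<close>

lemma (in noetherian_ring) exists_maximalideal: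
  assumes I: "ideal I R" "I \<noteq> carrier R"
  shows "\<exists>J. maximalideal J R \<and> I \<subseteq> J"
proof -
  let ?A = "{J. ideal J R \<and> I \<subseteq> J \<and> J \<noteq> carrier R}"
  have "\<exists>J\<in>?A. \<forall>K\<in>?A. J \<subseteq> K \<longrightarrow> K = J"
  proof (rule subset_Zorn_nonempty)
    show "?A \<noteq> {}" using I by blast
  next
    fix C assume C: "C \<noteq> {}" "subset.chain ?A C"
    then have "subset.chain {J. ideal J R} C" by (auto simp: subset_chain_def)
    then have "\<Union>C \<in> C" using ideal_chain_is_trivial C(1) by blast
    then show "\<Union>C \<in> ?A" using C(2) by (auto simp: subset_chain_def)
  qed
  then obtain J where J: "J \<in> ?A" and max: "\<forall>K\<in>?A. J \<subseteq> K \<longrightarrow> K = J" ..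
  have "maximalideal J R"
  proof (rule maximalidealI)
    show "ideal J R" "carrier R \<noteq> J" using J by auto
    show "K = J \<or> K = carrier R" if "ideal K R" "J \<subseteq> K" for K
      using that J max by blast
  qed
  then show ?thesis using J by blast
qed

text \<open>
  The annihilator of a nonzero element of the simple module \<open>N'/N\<close> is a maximal ideal: a larger
  ideal \<open>J\<close> gives the larger submodule \<open>J x + N\<close>, which must be \<open>N'\<close>, and writing
  \<open>x = j x + y\<close> exhibits \<open>1 - j\<close> as an element of the annihilator.
\<close>

lemma (in module) maximalideal_colon:
  assumes N: "submodule N R M" and N': "submodule N' R M" "N \<subseteq> N'"
    and simple: "\<nexists>L. submodule L R M \<and> N \<subset> L \<and> L \<subset> N'"
    and x: "x \<in> N'" "x \<notin> N"
  shows "maximalideal {a \<in> carrier R. a \<odot>\<^bsub>M\<^esub> x \<in> N} R"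
proof (rule maximalidealI)
  let ?I = "{a \<in> carrier R. a \<odot>\<^bsub>M\<^esub> x \<in> N}"
  have zN: "\<zero>\<^bsub>M\<^esub> \<in> N" by (rule submodule_zero[OF N])
  note N = submoduleE[OF N]
  note N' = submoduleE[OF N'(1)] N'(2)
  have xM: "x \<in> carrier M" using x N'(1) by blast
  show "ideal ?I R"
  proof (rule idealI)
    show "ring R" by (rule R.ring_axioms)
    show "subgroup ?I (add_monoid R)"
    proof (rule R.add.subgroupI)
      show "?I \<noteq> {}" using zN xM by (auto intro!: exI[of _ \<zero>])
    next
      fix a assume "a \<in> ?I"
      then show "\<ominus> a \<in> ?I" using N(3) smult_l_minus[OF _ xM] by auto
    next
      fix a b assume "a \<in> ?I" "b \<in> ?I"
      then show "a \<oplus> b \<in> ?I" using N(5) smult_l_distr[OF _ _ xM] by auto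
    qed blast
  next
    fix a b assume ab: "a \<in> ?I" "b \<in> carrier R"
    then show "b \<otimes> a \<in> ?I" using N(4) smult_assoc1[OF _ _ xM] by auto
    then show "a \<otimes> b \<in> ?I" using ab R.m_comm[of a b] by simp
  qed
  show "carrier R \<noteq> ?I"
  proof
    assume "carrier R = ?I"
    then have "\<one> \<in> ?I" using R.one_closed by blast
    then show False using x xM by simp
  qed
  fix J assume J: "ideal J R" "?I \<subseteq> J" "J \<subseteq> carrier R"
  interpret J: ideal J R by (rule J(1))
  show "J = ?I \<or> J = carrier R"
  proof (cases "J = ?I")
    case False
    then obtain b where b: "b \<in> J" "b \<in> carrier R" "b \<odot>\<^bsub>M\<^esub> x \<notin> N" using J by blast
    define L where "L = {j \<odot>\<^bsub>M\<^esub> x \<oplus>\<^bsub>M\<^esub> y | j y. j \<in> J \<and> y \<in> N}"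
    have inL: "z \<in> L" if "j \<in> J" "y \<in> N" "z = j \<odot>\<^bsub>M\<^esub> x \<oplus>\<^bsub>M\<^esub> y" for z j y
      using that unfolding L_def by blast
    have NM: "y \<in> carrier M" if "y \<in> N" for y using that N(1) by blast
    have JR: "j \<in> carrier R" if "j \<in> J" for j using that J(3) by blast
    have LN': "L \<subseteq> N'"
      unfolding L_def using N'(4,5) x(1) JR N'(7) by blast
    have "submodule L R M"
    proof (rule submoduleI)
      show "L \<subseteq> carrier M" using LN' N'(1) by blast
      show "\<zero>\<^bsub>M\<^esub> \<in> L"
        by (rule inL[OF J.zero_closed zN]) (use xM in simp)
    next
      fix z assume "z \<in> L"
      then obtain j y where z: "j \<in> J" "y \<in> N" "z = j \<odot>\<^bsub>M\<^esub> x \<oplus>\<^bsub>M\<^esub> y" unfolding L_def by blast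
      show "\<ominus>\<^bsub>M\<^esub> z \<in> L"
        by (rule inL[OF J.a_inv_closed[OF z(1)] N(3)[OF z(2)]])
          (use z xM JR NM in \<open>simp add: M.minus_add smult_l_minus\<close>)
    next
      fix z z' assume "z \<in> L" "z' \<in> L"
      then obtain j y j' y' where z: "j \<in> J" "y \<in> N" "z = j \<odot>\<^bsub>M\<^esub> x \<oplus>\<^bsub>M\<^esub> y"
        and z': "j' \<in> J" "y' \<in> N" "z' = j' \<odot>\<^bsub>M\<^esub> x \<oplus>\<^bsub>M\<^esub> y'" unfolding L_def by blast
      show "z \<oplus>\<^bsub>M\<^esub> z' \<in> L"
        by (rule inL[OF J.a_closed[OF z(1) z'(1)] N(5)[OF z(2) z'(2)]])
          (use z z' xM JR NM in \<open>simp add: smult_l_distr M.a_ac\<close>)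
    next
      fix a z assume a: "a \<in> carrier R" and "z \<in> L"
      then obtain j y where z: "j \<in> J" "y \<in> N" "z = j \<odot>\<^bsub>M\<^esub> x \<oplus>\<^bsub>M\<^esub> y" unfolding L_def by blast
      show "a \<odot>\<^bsub>M\<^esub> z \<in> L"
        by (rule inL[OF J.I_l_closed[OF z(1) a] N(4)[OF a z(2)]])
          (use z a xM JR NM in \<open>simp add: smult_r_distr smult_assoc1\<close>)
    qed
    moreover have "N \<subset> L"
    proof
      show "N \<subseteq> L"
      proof
        fix y assume y: "y \<in> N"
        show "y \<in> L" by (rule inL[OF J.zero_closed y]) (use xM NM[OF y] in simp)
      qed
      have "b \<odot>\<^bsub>M\<^esub> x \<in> L" by (rule inL[OF b(1) zN]) (use b(2) xM in simp)
      then show "N \<noteq> L" using b(3) by blast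
    qed
    ultimately have "L = N'" using simple LN' by blast
    then obtain j y where j: "j \<in> J" "y \<in> N" "x = j \<odot>\<^bsub>M\<^esub> x \<oplus>\<^bsub>M\<^esub> y"
      using x(1) unfolding L_def by blast
    have "(\<one> \<oplus> \<ominus> j) \<odot>\<^bsub>M\<^esub> x = x \<oplus>\<^bsub>M\<^esub> \<ominus>\<^bsub>M\<^esub> (j \<odot>\<^bsub>M\<^esub> x)"
      using JR[OF j(1)] xM by (simp add: smult_l_distr smult_l_minus)
    also have "\<dots> = (y \<oplus>\<^bsub>M\<^esub> j \<odot>\<^bsub>M\<^esub> x) \<oplus>\<^bsub>M\<^esub> \<ominus>\<^bsub>M\<^esub> (j \<odot>\<^bsub>M\<^esub> x)"
      using j(3) JR[OF j(1)] xM NM[OF j(2)] by (metis M.a_comm smult_closed)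
    also have "\<dots> = y"
      using JR[OF j(1)] xM NM[OF j(2)] by (simp add: M.a_assoc M.r_neg)
    finally have "\<one> \<oplus> \<ominus> j \<in> ?I" using j(2) JR[OF j(1)] by simp
    then have "(\<one> \<oplus> \<ominus> j) \<oplus> j \<in> J" using J(2) j(1) J.a_closed by blast
    then have "\<one> \<in> J" using JR[OF j(1)] by (simp add: R.a_assoc R.l_neg)
    then have "J = carrier R" by (rule J.one_imp_carrier)
    then show ?thesis ..
  qed (rule disjI1)
qed

text \<open>
  Each step of a composition series is killed by a maximal ideal, which contains an element outside
  \<open>P\<close>; the product of these elements kills \<open>x\<close>.
\<close>

lemma finite_length_locally_zero:
  assumes M: "finite_length R M" and P: "primeideal P R"
    and max: "\<And>I. maximalideal I R \<Longrightarrow> \<not> I \<subseteq> P"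
    and x: "x \<in> carrier M"
  shows "\<exists>u\<in>carrier R - P. u \<odot>\<^bsub>M\<^esub> x = \<zero>\<^bsub>M\<^esub>"
proof -
  interpret module R M using M by (simp add: finite_length_def)
  interpret P: primeideal P R by (rule P)
  obtain n N where N: "composition_series R M n N" using M by (auto simp: finite_length_def)
  then have sub: "\<And>i. i \<le> n \<Longrightarrow> submodule (N i) R M"
    and N0: "N 0 = {\<zero>\<^bsub>M\<^esub>}" and Nn: "N n = carrier M"
    and inc: "\<And>i. i < n \<Longrightarrow> N i \<subset> N (Suc i)"
    and simple: "\<And>i. i < n \<Longrightarrow> \<nexists>L. submodule L R M \<and> N i \<subset> L \<and> L \<subset> N (Suc i)"
    by (auto simp: composition_series_def)
  have "\<forall>x\<in>N i. \<exists>u\<in>carrier R - P. u \<odot>\<^bsub>M\<^esub> x = \<zero>\<^bsub>M\<^esub>" if "i \<le> n" for i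
    using that
  proof (induction i)
    case 0
    have "\<one>\<^bsub>R\<^esub> \<in> carrier R - P" using P.I_notcarr P.one_imp_carrier by auto
    then show ?case unfolding N0 by (intro ballI bexI[of _ "\<one>\<^bsub>R\<^esub>"]) auto
  next
    case (Suc i)
    have i: "i < n" "i \<le> n" using Suc.prems by auto
    show ?case
    proof
      fix x assume x: "x \<in> N (Suc i)"
      show "\<exists>u\<in>carrier R - P. u \<odot>\<^bsub>M\<^esub> x = \<zero>\<^bsub>M\<^esub>"
      proof (cases "x \<in> N i")
        case True
        then show ?thesis using Suc.IH[OF i(2)] by blast
      next
        case False
        have xM: "x \<in> carrier M" using submoduleE(1)[OF sub[OF Suc.prems]] x by blast
        have "maximalideal {a \<in> carrier R. a \<odot>\<^bsub>M\<^esub> x \<in> N i} R"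
          by (rule maximalideal_colon[OF sub[OF i(2)] sub[OF Suc.prems] _ simple[OF i(1)] x False])
            (use inc[OF i(1)] in blast)
        then obtain a where a: "a \<in> carrier R" "a \<odot>\<^bsub>M\<^esub> x \<in> N i" "a \<notin> P" using max by blast
        then obtain u where u: "u \<in> carrier R - P" "u \<odot>\<^bsub>M\<^esub> (a \<odot>\<^bsub>M\<^esub> x) = \<zero>\<^bsub>M\<^esub>"
          using Suc.IH[OF i(2)] by blast
        have "u \<otimes>\<^bsub>R\<^esub> a \<in> carrier R - P" using P.I_prime[of u a] u(1) a by auto
        moreover have "(u \<otimes>\<^bsub>R\<^esub> a) \<odot>\<^bsub>M\<^esub> x = \<zero>\<^bsub>M\<^esub>" using u a(1) xM by (simp add: smult_assoc1)
        ultimately show ?thesis by blast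
      qed
    qed
  qed
  then show ?thesis using Nn x by blast
qed

lemma krull_dim_pos:
  assumes "krull_dim R > 0"
  obtains Q Q' where "primeideal Q R" "primeideal Q' R" "Q \<subset> Q'"
proof -
  obtain n P where n: "0 < enat n" "\<forall>i\<le>n. P i \<in> Spec R" "\<forall>i<n. P i \<subset> P (Suc i)"
    using assms by (auto simp: krull_dim_def less_Sup_iff)
  then have n0: "0 < n" by (simp add: zero_enat_def)
  have "P 0 \<subset> P (Suc 0)" "P 0 \<in> Spec R" "P (Suc 0) \<in> Spec R"
    using n(2,3) n0 by (auto simp: Suc_le_eq)
  then show ?thesis using that by (auto simp: Spec_def)
qed

text \<open>
  Otherwise every prime lies in \<open>P\<close>, as \<open>I\<close> is the only maximal ideal. But an element \<open>a \<in> Q' - Q\<close> of a chain \<open>Q \<subset> Q' \<subseteq> P\<close> of primes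
  is killed by some \<open>u \<notin> P\<close>, and \<open>u a = 0 \<in> Q\<close> contradicts primality of \<open>Q\<close>.
\<close>

lemma maximalideal_not_subset_locally_field_prime:
  assumes P: "locally_field_prime P R" and local: "local_ring R" and noeth: "noetherian_ring R"
    and dim: "krull_dim R > 0" and I: "maximalideal I R"
  shows "\<not> I \<subseteq> P"
proof
  assume IP: "I \<subseteq> P"
  interpret locally_field_prime P R by (rule P)
  interpret noetherian_ring R by (rule noeth)
  obtain Q Q' where Q: "primeideal Q R" "primeideal Q' R" "Q \<subset> Q'"
    using krull_dim_pos[OF dim] .
  obtain J where "maximalideal J R" "Q' \<subseteq> J"
    using exists_maximalideal primeideal.axioms(1)[OF Q(2)] primeideal.I_notcarr[OF Q(2)] by blast
  then have "Q' \<subseteq> I" using local I unfolding local_ring_def by blast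
  then have Q'P: "Q' \<subseteq> P" using IP by blast
  obtain a where a: "a \<in> Q'" "a \<notin> Q" using Q(3) by blast
  then obtain u where u: "u \<in> carrier R - P" "u \<otimes>\<^bsub>R\<^esub> a = \<zero>\<^bsub>R\<^esub>"
    using killed_outside Q'P by blast
  have "\<zero>\<^bsub>R\<^esub> \<in> Q"
    by (rule additive_subgroup.zero_closed[OF ideal.axioms(1)[OF primeideal.axioms(1)[OF Q(1)]]])
  then have "u \<in> Q \<or> a \<in> Q"
    using primeideal.I_prime[OF Q(1), of u a] u a(1) Q'P Icarr by auto
  then show False using a(2) u(1) Q(3) Q'P by blast
qed

text \<open>
  A reduced ring embeds into the product of its localizations at minimal primes.
\<close>

lemma (in cring) reduced_zero_if_locally_zero:
  assumes red: "reduced_ring R" and x: "x \<in> carrier R"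
    and killed: "\<And>P. locally_field_prime P R \<Longrightarrow> \<exists>u\<in>carrier R - P. u \<otimes> x = \<zero>"
  shows "x = \<zero>"
proof (rule ccontr)
  assume nz: "x \<noteq> \<zero>"
  let ?W = "range (\<lambda>n::nat. x [^] n)"
  have "\<exists>P. locally_field_prime P R \<and> P \<inter> ?W = {}"
  proof (rule maximal_submonoid_prime[OF red])
    show "?W \<subseteq> carrier R" using x by auto
    show "\<one> \<in> ?W" by (rule range_eqI[of _ _ 0]) simp
    show "a \<otimes> b \<in> ?W" if ab: "a \<in> ?W" "b \<in> ?W" for a b
    proof -
      obtain n m :: nat where "a = x [^] n" "b = x [^] m" using ab by blast
      then have "a \<otimes> b = x [^] (n + m)" using x by (simp add: nat_pow_mult)
      then show ?thesis by blast
    qed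
    show "\<zero> \<notin> ?W"
    proof
      assume "\<zero> \<in> ?W"
      then obtain n :: nat where "x [^] n = \<zero>" by auto
      then show False using red x nz unfolding reduced_ring_def by blast
    qed
  qed
  then obtain P where P: "locally_field_prime P R" "P \<inter> ?W = {}" by blast
  interpret P: locally_field_prime P R by (rule P(1))
  obtain u where u: "u \<in> carrier R - P" "u \<otimes> x = \<zero>" using killed[OF P(1)] by blast
  have "x \<in> P" using P.I_prime[of u x] u x P.zero_closed by auto
  moreover have "x \<in> ?W" by (rule range_eqI[of _ _ 1]) (use x in simp)
  ultimately show False using P(2) by blast
qed


section \<open>Projective dimension from a truncated resolution\<close>

text \<open>
  The projective dimension is defined by resolutions with modules on a fixed type of lists, while
  the free modules of a resolution consist of functions. Transport along an injection \<open>\<phi>\<close> moves them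
  to that type.
\<close>

definition transport_module :: "('a, 'c, 'm) module_scheme \<Rightarrow> ('c \<Rightarrow> 'd) \<Rightarrow> ('a, 'd) module" where
  "transport_module M \<phi> =
     (let \<psi> = inv_into (carrier M) \<phi> in
     \<lparr>carrier = \<phi> ` carrier M, monoid.mult = undefined, one = undefined, zero = \<phi> \<zero>\<^bsub>M\<^esub>,
      add = (\<lambda>x y. \<phi> (\<psi> x \<oplus>\<^bsub>M\<^esub> \<psi> y)), smult = (\<lambda>a x. \<phi> (a \<odot>\<^bsub>M\<^esub> \<psi> x))\<rparr>)"

lemma transport_module_simps:
  "carrier (transport_module M \<phi>) = \<phi> ` carrier M"
  "\<zero>\<^bsub>transport_module M \<phi>\<^esub> = \<phi> \<zero>\<^bsub>M\<^esub>"
  "x \<oplus>\<^bsub>transport_module M \<phi>\<^esub> y =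
     \<phi> (inv_into (carrier M) \<phi> x \<oplus>\<^bsub>M\<^esub> inv_into (carrier M) \<phi> y)"
  "a \<odot>\<^bsub>transport_module M \<phi>\<^esub> x = \<phi> (a \<odot>\<^bsub>M\<^esub> inv_into (carrier M) \<phi> x)"
  by (simp_all add: transport_module_def Let_def)

context module
begin

lemma module_transport:
  assumes inj: "inj_on \<phi> (carrier M)"
  shows "module R (transport_module M \<phi>)"
proof -
  note [simp] = inv_into_f_f[OF inj] transport_module_simps
  have "abelian_group (transport_module M \<phi>)"
  proof (rule abelian_groupI)
    fix x y z
    assume "x \<in> carrier (transport_module M \<phi>)" "y \<in> carrier (transport_module M \<phi>)"
      "z \<in> carrier (transport_module M \<phi>)"
    then obtain x' y' z' where "x = \<phi> x'" "y = \<phi> y'" "z = \<phi> z'"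
      "x' \<in> carrier M" "y' \<in> carrier M" "z' \<in> carrier M" by auto
    then show "x \<oplus>\<^bsub>transport_module M \<phi>\<^esub> y \<oplus>\<^bsub>transport_module M \<phi>\<^esub> z =
        x \<oplus>\<^bsub>transport_module M \<phi>\<^esub> (y \<oplus>\<^bsub>transport_module M \<phi>\<^esub> z)"
      by (simp add: M.a_assoc)
  next
    fix x assume "x \<in> carrier (transport_module M \<phi>)"
    then obtain x' where x': "x = \<phi> x'" "x' \<in> carrier M" by auto
    show "\<exists>y\<in>carrier (transport_module M \<phi>).
        y \<oplus>\<^bsub>transport_module M \<phi>\<^esub> x = \<zero>\<^bsub>transport_module M \<phi>\<^esub>"
      by (rule bexI[of _ "\<phi> (\<ominus>\<^bsub>M\<^esub> x')"]) (use x' in \<open>simp_all add: M.l_neg\<close>)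
  qed (auto simp: M.a_comm)
  then show ?thesis
    by (intro moduleI R.is_cring)
      (auto simp: smult_l_distr smult_r_distr smult_assoc1)
qed

lemma transport_hom:
  assumes inj: "inj_on \<phi> (carrier M)"
  shows "\<phi> \<in> mod_hom R M (transport_module M \<phi>)"
    and "inv_into (carrier M) \<phi> \<in> mod_hom R (transport_module M \<phi>) M"
  by (auto simp: mod_hom_def hom_def transport_module_simps inv_into_f_f[OF inj])

end

lemma mod_hom_comp:
  assumes "g \<in> mod_hom R L M" "h \<in> mod_hom R M N"
  shows "h \<circ> g \<in> mod_hom R L N"
  using assms by (auto simp: mod_hom_def hom_def Pi_iff)

lemma resolution_transport:
  assumes res: "resolution R M F f \<epsilon>" and inj: "\<And>i. inj_on (\<phi> i) (carrier (F i))"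
  defines "\<psi> \<equiv> \<lambda>i. inv_into (carrier (F i)) (\<phi> i)"
  shows "resolution R M (\<lambda>i. transport_module (F i) (\<phi> i))
    (\<lambda>i. \<phi> (i - 1) \<circ> f i \<circ> \<psi> i) (\<epsilon> \<circ> \<psi> 0)"
proof -
  have modF: "module R (F i)" for i using res by (simp add: resolution_def)
  let ?T = "\<lambda>i. transport_module (F i) (\<phi> i)"
  have \<phi>: "\<phi> i \<in> mod_hom R (F i) (?T i)" and \<psi>: "\<psi> i \<in> mod_hom R (?T i) (F i)" for i
    unfolding \<psi>_def using module.transport_hom[OF modF inj] by auto
  have \<psi>\<phi>: "\<psi> i (\<phi> i x) = x" if "x \<in> carrier (F i)" for i x
    unfolding \<psi>_def using inv_into_f_f[OF inj that] .
  have f: "f (Suc i) \<in> mod_hom R (F (Suc i)) (F i)" for i using res by (simp add: resolution_def)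
  have f_closed: "f (Suc i) x \<in> carrier (F i)" if "x \<in> carrier (F (Suc i))" for i x
    using f[of i] that by (auto simp: mod_hom_def hom_def)
  have zF: "\<zero>\<^bsub>F i\<^esub> \<in> carrier (F i)" for i
    using modF[of i] by (meson abelian_group.axioms(1) abelian_monoid.zero_closed module.axioms(2))
  have image: "(\<phi> i \<circ> f (Suc i) \<circ> \<psi> (Suc i)) ` carrier (?T (Suc i)) =
      \<phi> i ` f (Suc i) ` carrier (F (Suc i))" for i
    using \<psi>\<phi> by (force simp: transport_module_simps image_iff)
  have eqz: "\<phi> i y = \<phi> i \<zero>\<^bsub>F i\<^esub> \<longleftrightarrow> y = \<zero>\<^bsub>F i\<^esub>" if "y \<in> carrier (F i)" for i y
    using inj_on_eq_iff[OF inj that zF] .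
  have kernel: "a_kernel (?T (Suc i)) (?T i) (\<phi> i \<circ> f (Suc i) \<circ> \<psi> (Suc i)) =
      \<phi> (Suc i) ` a_kernel (F (Suc i)) (F i) (f (Suc i))" for i
    using \<psi>\<phi> eqz f_closed by (auto simp: transport_module_simps a_kernel_def')
  have kernel0: "a_kernel (?T 0) M (\<epsilon> \<circ> \<psi> 0) = \<phi> 0 ` a_kernel (F 0) M \<epsilon>"
    using \<psi>\<phi> by (auto simp: transport_module_simps a_kernel_def')
  have "(\<epsilon> \<circ> \<psi> 0) ` carrier (?T 0) = \<epsilon> ` carrier (F 0)"
    using \<psi>\<phi> by (force simp: transport_module_simps image_iff)
  moreover have "\<phi> i \<circ> f (Suc i) \<circ> \<psi> (Suc i) \<in> mod_hom R (?T (Suc i)) (?T i)" for i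
    by (intro mod_hom_comp[OF \<psi>] mod_hom_comp[OF f] \<phi>)
  moreover have "\<epsilon> \<circ> \<psi> 0 \<in> mod_hom R (?T 0) M"
    using res by (intro mod_hom_comp[OF \<psi>]) (simp add: resolution_def)
  ultimately show ?thesis
    using res module.module_transport[OF modF inj] image[of 0] image[of "Suc _"]
    by (simp add: resolution_def kernel kernel0)
qed

text \<open>
  The basis required by the definition of projectivity has to live in the type \<open>'d\<close> of the
  transported elements; the injection \<open>c\<close> provides \<open>n\<close> distinct elements of it.
\<close>

lemma projective_transport_free:
  fixes \<phi> :: "(nat \<Rightarrow> 'a) \<Rightarrow> 'd"
  assumes F: "module R (free_module R {..<n})"
    and inj: "inj_on \<phi> (carrier (free_module R {..<n}))"
    and c: "inj (c :: nat \<Rightarrow> 'd)"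
  shows "projective_module R (transport_module (free_module R {..<n}) \<phi>)"
proof -
  let ?F = "free_module R {..<n}"
  let ?T = "transport_module ?F \<phi>"
  let ?G = "free_module R (c ` {..<n})"
  let ?\<psi> = "inv_into (carrier ?F) \<phi>"
  interpret F: module R ?F by (rule F)
  define i where "i v = (\<lambda>d. if d \<in> c ` {..<n} then v (inv_into UNIV c d) else \<zero>\<^bsub>R\<^esub>)" for v :: "nat \<Rightarrow> 'a"
  define p where "p w = (\<lambda>k. if k < n then w (c k) else \<zero>\<^bsub>R\<^esub>)" for w :: "'d \<Rightarrow> 'a"
  have carG: "w \<in> carrier ?G \<longleftrightarrow> (\<forall>d. w d \<in> carrier R) \<and> (\<forall>d. d \<notin> c ` {..<n} \<longrightarrow> w d = \<zero>\<^bsub>R\<^esub>)" for w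
  proof -
    have "finite {d. w d \<noteq> \<zero>\<^bsub>R\<^esub>}" if "\<forall>d. d \<notin> c ` {..<n} \<longrightarrow> w d = \<zero>\<^bsub>R\<^esub>"
      by (rule finite_subset[of _ "c ` {..<n}"]) (use that in auto)
    then show ?thesis by (auto simp: free_module_def)
  qed
  have i: "i \<in> mod_hom R ?F ?G"
    by (auto simp: mod_hom_def hom_def carG free_module_carrier_iff free_module_simps i_def fun_eq_iff)
  have p: "p \<in> mod_hom R ?G ?F"
    by (auto simp: mod_hom_def hom_def carG free_module_carrier_iff free_module_simps p_def fun_eq_iff)
  have pi: "p (i v) = v" if "v \<in> carrier ?F" for v
    using that by (auto simp: p_def i_def free_module_carrier_iff fun_eq_iff inv_f_f[OF c] not_less)
  have "i \<circ> ?\<psi> \<in> mod_hom R ?T ?G"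
    by (rule mod_hom_comp[OF F.transport_hom(2)[OF inj] i])
  moreover have "\<phi> \<circ> p \<in> mod_hom R ?G ?T"
    by (rule mod_hom_comp[OF p F.transport_hom(1)[OF inj]])
  moreover have "(\<phi> \<circ> p) ((i \<circ> ?\<psi>) x) = x" if x: "x \<in> carrier ?T" for x
  proof -
    obtain v where v: "v \<in> carrier ?F" "x = \<phi> v" using x by (auto simp: transport_module_simps)
    show ?thesis unfolding v(2) by (simp add: inv_into_f_f[OF inj v(1)] pi[OF v(1)])
  qed
  ultimately show ?thesis
    unfolding projective_module_def using F.module_transport[OF inj] by blast
qed

lemma truncated_resolution:
  fixes \<beta> :: "nat \<Rightarrow> nat"
  assumes res: "resolution R M (\<lambda>j. free_module R {..<\<beta> j}) f \<epsilon>"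
    and zero: "\<And>x. x \<in> carrier (free_module R {..<\<beta> (Suc i)}) \<Longrightarrow>
      f (Suc i) x = \<zero>\<^bsub>free_module R {..<\<beta> i}\<^esub>"
  shows "resolution R M (\<lambda>j. free_module R {..<if j \<le> i then \<beta> j else 0})
    (\<lambda>j. if j \<le> i then f j else (\<lambda>_ _. \<zero>\<^bsub>R\<^esub>)) \<epsilon>"
proof -
  let ?F = "\<lambda>j. free_module R {..<\<beta> j}" and ?O = "free_module R ({} :: nat set)"
  let ?F' = "\<lambda>j. free_module R {..<if j \<le> i then \<beta> j else 0}"
  let ?f = "\<lambda>j. if j \<le> i then f j else (\<lambda>_ _. \<zero>\<^bsub>R\<^esub>)"
  have modF: "module R (?F j)" for j using res by (simp add: resolution_def)
  interpret R: cring R using modF[of 0] by (rule module.axioms(1))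
  have O: "carrier ?O = {\<lambda>_. \<zero>\<^bsub>R\<^esub>}" by (auto simp: free_module_def)
  have "abelian_group ?O"
    by (rule abelian_groupI) (auto simp: O free_module_simps)
  then have modO: "module R ?O"
    by (intro moduleI R.is_cring) (auto simp: O free_module_simps)
  have "module R (?F' j)" for j using modF modO by simp
  moreover have "?f (Suc j) \<in> mod_hom R (?F' (Suc j)) (?F' j)" for j
  proof (cases "Suc j \<le> i")
    case True
    then show ?thesis using res by (simp add: resolution_def)
  next
    case False
    then show ?thesis
      by (auto simp: mod_hom_def hom_def O free_module_simps free_module_carrier_iff)
  qed
  moreover have kerO: "a_kernel ?O N h = {\<lambda>_. \<zero>\<^bsub>R\<^esub>}"
    if "h (\<lambda>_. \<zero>\<^bsub>R\<^esub>) = \<zero>\<^bsub>N\<^esub>" for h and N :: "('a, nat \<Rightarrow> 'a) module"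
    using that by (auto simp: a_kernel_def' O)
  have img: "f (Suc i) ` carrier (?F (Suc i)) = {\<lambda>_. \<zero>\<^bsub>R\<^esub>}"
  proof -
    have "(\<lambda>_. \<zero>\<^bsub>R\<^esub>) \<in> carrier (?F (Suc i))" by (simp add: free_module_carrier_iff)
    then show ?thesis using zero by (force simp: free_module_simps)
  qed
  have "?f 1 ` carrier (?F' 1) = a_kernel (?F' 0) M \<epsilon>"
  proof (cases "i = 0")
    case True
    then show ?thesis using res img by (simp add: resolution_def O)
  next
    case False
    then show ?thesis using res by (simp add: resolution_def)
  qed
  moreover have "?f (Suc (Suc j)) ` carrier (?F' (Suc (Suc j))) =
      a_kernel (?F' (Suc j)) (?F' j) (?f (Suc j))" for j
  proof -
    have ex: "f (Suc (Suc j)) ` carrier (?F (Suc (Suc j))) = a_kernel (?F (Suc j)) (?F j) (f (Suc j))"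
      using res by (simp add: resolution_def)
    consider "Suc (Suc j) \<le> i" | "Suc j = i" | "i < Suc j" by linarith
    then show ?thesis
    proof cases
      case 1
      then show ?thesis using ex by simp
    next
      case 2
      have "a_kernel (?F (Suc j)) (?F j) (f (Suc j)) = {\<lambda>_. \<zero>\<^bsub>R\<^esub>}"
        using ex img unfolding 2 by simp
      with 2 show ?thesis by (simp add: O)
    next
      case 3
      then show ?thesis by (simp add: O kerO free_module_simps)
    qed
  qed
  ultimately show ?thesis using res by (simp add: resolution_def)
qed

lemma proj_dim_le_of_zero_boundary:
  fixes R :: "('a, 'r) ring_scheme" and M :: "('a, 'b, 'm) module_scheme" and \<beta> :: "nat \<Rightarrow> nat"
  assumes res: "resolution R M (\<lambda>j. free_module R {..<\<beta> j}) f \<epsilon>"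
    and zero: "\<And>x. x \<in> carrier (free_module R {..<\<beta> (Suc i)}) \<Longrightarrow>
      f (Suc i) x = \<zero>\<^bsub>free_module R {..<\<beta> i}\<^esub>"
  shows "proj_dim R M \<le> enat i"
proof -
  define \<beta>' where "\<beta>' j = (if j \<le> i then \<beta> j else 0)" for j
  define f' where "f' j = (if j \<le> i then f j else (\<lambda>_ _. \<zero>\<^bsub>R\<^esub>))" for j
  let ?F = "\<lambda>j. free_module R {..<\<beta>' j}"
  define \<phi> :: "nat \<Rightarrow> (nat \<Rightarrow> 'a) \<Rightarrow> ('a + 'b) list"
    where "\<phi> j v = map (\<lambda>k. Inl (v k)) [0..<\<beta>' j]" for j v
  have res': "resolution R M ?F f' \<epsilon>"
    unfolding \<beta>'_def f'_def by (rule truncated_resolution[OF res zero])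
  have inj: "inj_on (\<phi> j) (carrier (?F j))" for j
  proof (rule inj_onI)
    fix v w assume v: "v \<in> carrier (?F j)" and w: "w \<in> carrier (?F j)" and "\<phi> j v = \<phi> j w"
    then have "v k = w k" if "k < \<beta>' j" for k
      using that by (auto simp: \<phi>_def)
    moreover have "v k = w k" if "\<not> k < \<beta>' j" for k
      using that v w by (simp add: free_module_carrier_iff)
    ultimately show "v = w" by blast
  qed
  let ?T = "\<lambda>j. transport_module (?F j) (\<phi> j)"
  \<comment> \<open>lists of different lengths serve as basis elements\<close>
  have "inj (\<lambda>k. replicate k (undefined :: 'a + 'b))"
    by (rule injI) (metis length_replicate)
  then have "projective_module R (?T j)" for j
    using res' by (intro projective_transport_free inj) (simp_all add: resolution_def)
  moreover have "carrier (?T j) = {\<zero>\<^bsub>?T j\<^esub>}" if "j > i" for j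
  proof -
    have "\<zero>\<^bsub>?F j\<^esub> \<in> carrier (?F j)"
      using res' by (meson abelian_group.axioms(1) abelian_monoid.zero_closed module.axioms(2)
        resolution_def)
    moreover have "v = \<zero>\<^bsub>?F j\<^esub>" if "v \<in> carrier (?F j)" for v
      using that \<open>j > i\<close> by (auto simp: \<beta>'_def free_module_def)
    ultimately have "carrier (?F j) = {\<zero>\<^bsub>?F j\<^esub>}" by blast
    then show ?thesis by (simp add: transport_module_simps)
  qed
  ultimately have "\<exists>(P :: nat \<Rightarrow> ('a, ('a + 'b) list) module) d \<epsilon>. resolution R M P d \<epsilon> \<and>
      (\<forall>j. projective_module R (P j)) \<and> (\<forall>j>i. carrier (P j) = {\<zero>\<^bsub>P j\<^esub>})"
    using resolution_transport[OF res' inj] by blast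
  then show ?thesis unfolding proj_dim_def by (intro Inf_lower) blast
qed


section \<open>Support of syzygy modules\<close>

text \<open>
  An element of the zero module \<open>Q\<^sub>P\<close> has the same fraction over \<open>1\<close> as zero. The
  factors \<open>1\<close> are the denominators of the two fractions; removing them would
  require the module axioms for \<open>Q\<close>.
\<close>

lemma killed_if_not_in_Supp:
  assumes P: "P \<in> Spec R" "P \<notin> Supp R Q" and x: "x \<in> carrier Q"
  shows "\<exists>u\<in>carrier R - P. u \<odot>\<^bsub>Q\<^esub> (\<one>\<^bsub>R\<^esub> \<odot>\<^bsub>Q\<^esub> \<zero>\<^bsub>Q\<^esub>) = u \<odot>\<^bsub>Q\<^esub> (\<one>\<^bsub>R\<^esub> \<odot>\<^bsub>Q\<^esub> x)"
proof -
  interpret P: primeideal P R using P(1) by (simp add: Spec_def)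
  have one: "\<one>\<^bsub>R\<^esub> \<in> carrier R - P" using P.I_notcarr P.one_imp_carrier by auto
  have "loc_rel R Q P `` {(x, \<one>\<^bsub>R\<^esub>)} \<in> carrier (localization R Q P)"
    using x one by (auto simp: localization_def intro: quotientI)
  moreover have "carrier (localization R Q P) = {loc_rel R Q P `` {(\<zero>\<^bsub>Q\<^esub>, \<one>\<^bsub>R\<^esub>)}}"
    using P by (auto simp: Supp_def localization_def)
  ultimately have "loc_rel R Q P `` {(x, \<one>\<^bsub>R\<^esub>)} = loc_rel R Q P `` {(\<zero>\<^bsub>Q\<^esub>, \<one>\<^bsub>R\<^esub>)}" by simp
  moreover have "((x, \<one>\<^bsub>R\<^esub>), (x, \<one>\<^bsub>R\<^esub>)) \<in> loc_rel R Q P"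
    using x one by (auto simp: loc_rel_def)
  ultimately have "((\<zero>\<^bsub>Q\<^esub>, \<one>\<^bsub>R\<^esub>), (x, \<one>\<^bsub>R\<^esub>)) \<in> loc_rel R Q P" by blast
  then show ?thesis by (auto simp: loc_rel_def)
qed

text \<open>
  Multiplication by a scalar in the quotient is a union of cosets, so it can be evaluated at the
  representative \<open>x\<close> without knowing that the quotient is a module.
\<close>

lemma (in module) mult_in_submodule_if_not_in_Supp:
  assumes P: "P \<in> Spec R" "P \<notin> Supp R (quot_module M K)"
    and K: "submodule K R M" and x: "x \<in> carrier M"
  shows "\<exists>u\<in>carrier R - P. u \<odot>\<^bsub>M\<^esub> x \<in> K"
proof -
  let ?Q = "quot_module M K"
  note KM = submoduleE(1)[OF K] and K_add = submoduleE(5)[OF K] and K_smult = submoduleE(4)[OF K]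
  have K0: "\<zero>\<^bsub>M\<^esub> \<in> K" by (rule submodule_zero[OF K])
  have smult: "a \<odot>\<^bsub>?Q\<^esub> C = (\<Union>y\<in>C. K +>\<^bsub>M\<^esub> (a \<odot>\<^bsub>M\<^esub> y))" for a C
    by (simp add: quot_module_def)
  have self: "y \<in> K +>\<^bsub>M\<^esub> y" if "y \<in> carrier M" for y
    using that K0 unfolding a_r_coset_def' by force
  have sub: "a \<odot>\<^bsub>?Q\<^esub> C \<subseteq> K" if "a \<in> carrier R" "C \<subseteq> K" for a C
  proof
    fix z assume "z \<in> a \<odot>\<^bsub>?Q\<^esub> C"
    then obtain y k where "y \<in> C" "k \<in> K" "z = k \<oplus>\<^bsub>M\<^esub> a \<odot>\<^bsub>M\<^esub> y"
      unfolding smult a_r_coset_def' by blast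
    then show "z \<in> K" using K_add K_smult that by blast
  qed
  have mem: "a \<odot>\<^bsub>M\<^esub> y \<in> a \<odot>\<^bsub>?Q\<^esub> C" if "a \<in> carrier R" "y \<in> C" "y \<in> carrier M" for a y C
    unfolding smult using that self by blast
  have "K +>\<^bsub>M\<^esub> x \<in> carrier ?Q"
    using x by (auto simp: quot_module_def A_RCOSETS_def')
  then obtain u where u: "u \<in> carrier R - P"
      "u \<odot>\<^bsub>?Q\<^esub> (\<one> \<odot>\<^bsub>?Q\<^esub> \<zero>\<^bsub>?Q\<^esub>) = u \<odot>\<^bsub>?Q\<^esub> (\<one> \<odot>\<^bsub>?Q\<^esub> (K +>\<^bsub>M\<^esub> x))"
    using killed_if_not_in_Supp[OF P] by blast
  have uR: "u \<in> carrier R" using u(1) by blast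
  have "x \<in> \<one> \<odot>\<^bsub>?Q\<^esub> (K +>\<^bsub>M\<^esub> x)" using mem[OF R.one_closed self[OF x] x] x by simp
  then have "u \<odot>\<^bsub>M\<^esub> x \<in> u \<odot>\<^bsub>?Q\<^esub> (\<one> \<odot>\<^bsub>?Q\<^esub> (K +>\<^bsub>M\<^esub> x))" by (rule mem[OF uR _ x])
  moreover have "\<zero>\<^bsub>?Q\<^esub> = K" by (simp add: quot_module_def)
  then have "u \<odot>\<^bsub>?Q\<^esub> (\<one> \<odot>\<^bsub>?Q\<^esub> \<zero>\<^bsub>?Q\<^esub>) \<subseteq> K" using sub[OF uR sub[OF R.one_closed]] by simp
  ultimately show ?thesis using u by blast
qed

text \<open>
  The cokernel of \<open>f (i + 2)\<close> is isomorphic to the image of \<open>f (i + 1)\<close> by exactness; at a prime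
  outside the support of the former, the latter vanishes too.
\<close>

lemma boundaries_killed_if_not_in_Supp_Syz:
  assumes res: "resolution R M (\<lambda>i. free_module R {..<\<beta> i}) f \<epsilon>"
    and P: "P \<in> Spec R" "P \<notin> Supp R (Syz R \<beta> f (Suc i))"
    and x: "x \<in> carrier (free_module R {..<\<beta> (Suc i)})"
  shows "\<exists>u\<in>carrier R - P. u \<odot>\<^bsub>free_module R {..<\<beta> i}\<^esub> f (Suc i) x = \<zero>\<^bsub>free_module R {..<\<beta> i}\<^esub>"
proof -
  let ?F = "\<lambda>i. free_module R {..<\<beta> i}"
  let ?K = "a_kernel (?F (Suc i)) (?F i) (f (Suc i))"
  interpret F: module R "?F (Suc i)" using res by (simp add: resolution_def)
  interpret F': module R "?F i" using res by (simp add: resolution_def)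
  have f: "f (Suc i) \<in> mod_hom R (?F (Suc i)) (?F i)" using res by (simp add: resolution_def)
  then have f_smult: "f (Suc i) (a \<odot>\<^bsub>?F (Suc i)\<^esub> y) = a \<odot>\<^bsub>?F i\<^esub> f (Suc i) y"
    and f_add: "f (Suc i) (y \<oplus>\<^bsub>?F (Suc i)\<^esub> z) = f (Suc i) y \<oplus>\<^bsub>?F i\<^esub> f (Suc i) z"
    and f_closed: "f (Suc i) y \<in> carrier (?F i)"
    if "a \<in> carrier R" "y \<in> carrier (?F (Suc i))" "z \<in> carrier (?F (Suc i))" for a y z
    using that by (auto simp: mod_hom_def hom_def)
  have "saturated R (carrier R) (?F (Suc i)) ?K"
  proof (rule F.saturatedI)
    show "\<zero>\<^bsub>?F (Suc i)\<^esub> \<in> ?K"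
      using f_smult[of "\<zero>\<^bsub>R\<^esub>" "\<zero>\<^bsub>?F (Suc i)\<^esub>" "\<zero>\<^bsub>?F (Suc i)\<^esub>"]
        f_closed[of "\<zero>\<^bsub>R\<^esub>" "\<zero>\<^bsub>?F (Suc i)\<^esub>" "\<zero>\<^bsub>?F (Suc i)\<^esub>"]
      by (simp add: a_kernel_def')
  next
    fix y z assume "y \<in> ?K" "z \<in> ?K"
    then show "y \<oplus>\<^bsub>?F (Suc i)\<^esub> z \<in> ?K"
      using f_add[of "\<zero>\<^bsub>R\<^esub>" y z] by (simp add: a_kernel_def')
  next
    fix a y assume "a \<in> carrier R" "y \<in> ?K"
    then show "a \<odot>\<^bsub>?F (Suc i)\<^esub> y \<in> ?K"
      using f_smult[of a y y] by (simp add: a_kernel_def')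
  qed (auto simp: a_kernel_def')
  then have K: "submodule ?K R (?F (Suc i))" by (simp add: saturated_def)
  have "Syz R \<beta> f (Suc i) = quot_module (?F (Suc i)) ?K"
    using res by (simp add: Syz_def coker_module_def resolution_def)
  then obtain u where u: "u \<in> carrier R - P" "u \<odot>\<^bsub>?F (Suc i)\<^esub> x \<in> ?K"
    using F.mult_in_submodule_if_not_in_Supp[OF P(1) _ K x] P(2) by auto
  then have "u \<odot>\<^bsub>?F i\<^esub> f (Suc i) x = \<zero>\<^bsub>?F i\<^esub>"
    using f_smult[of u x x] x by (simp add: a_kernel_def')
  then show ?thesis using u(1) by blast
qed

theorem mainTheorem3:
  fixes R :: "('a, 'r) ring_scheme" and M :: "('a, 'b, 'm) module_scheme"
    and \<beta> :: "nat \<Rightarrow> nat" and f :: "nat \<Rightarrow> (nat \<Rightarrow> 'a) \<Rightarrow> (nat \<Rightarrow> 'a)"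
    and \<epsilon> :: "(nat \<Rightarrow> 'a) \<Rightarrow> 'b"
  assumes "cring R" and "noetherian_ring R" and "local_ring R" and "reduced_ring R"
    and "krull_dim R > 0"
    and "module R M" and "finite_length R M"
    and "proj_dim R M = \<infinity>"
    and "minimal_free_resolution R M \<beta> f \<epsilon>"
  shows "\<forall>i>0. Supp R (Syz R \<beta> f i) = Spec R"
proof (intro allI impI)
  fix i :: nat assume "0 < i"
  then obtain j where i: "i = Suc j" by (cases i) auto
  interpret R: cring R by fact
  let ?F = "\<lambda>i. free_module R {..<\<beta> i}"
  have res: "resolution R M ?F f \<epsilon>"
    using assms(9) by (simp add: minimal_free_resolution_def)
  have M_zero: "\<exists>u\<in>carrier R - P. u \<odot>\<^bsub>M\<^esub> x = \<zero>\<^bsub>M\<^esub>"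
    if P: "locally_field_prime P R" and x: "x \<in> carrier M" for P x
  proof (rule finite_length_locally_zero[OF assms(7) _ _ x])
    show "primeideal P R" using P by (simp add: locally_field_prime_def)
    show "\<not> I \<subseteq> P" if "maximalideal I R" for I
      using maximalideal_not_subset_locally_field_prime[OF P assms(3,2,5) that] .
  qed
  have "P \<in> Supp R (Syz R \<beta> f i)" if P: "P \<in> Spec R" for P
  proof (rule ccontr)
    assume "P \<notin> Supp R (Syz R \<beta> f i)"
    then have killed: "\<exists>u\<in>carrier R - P. u \<odot>\<^bsub>?F j\<^esub> f (Suc j) x = \<zero>\<^bsub>?F j\<^esub>"
      if "x \<in> carrier (?F (Suc j))" for x
      using boundaries_killed_if_not_in_Supp_Syz[OF res P _ that] i by blast
    interpret P: primeideal P R using P by (simp add: Spec_def)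
    \<comment> \<open>a minimal prime below \<open>P\<close>\<close>
    have "\<exists>Q. locally_field_prime Q R \<and> Q \<inter> (carrier R - P) = {}"
    proof (rule R.maximal_submonoid_prime[OF assms(4)])
      show "\<one>\<^bsub>R\<^esub> \<in> carrier R - P" using P.I_notcarr P.one_imp_carrier by auto
      show "a \<otimes>\<^bsub>R\<^esub> b \<in> carrier R - P" if "a \<in> carrier R - P" "b \<in> carrier R - P" for a b
        using P.I_prime[of a b] that by auto
    qed auto
    then obtain Q where Q: "locally_field_prime Q R" "carrier R - P \<subseteq> carrier R - Q" by blast
    have rank: "alternating_rank \<beta> j = 0"
      using locally_field_prime.boundaries_locally_zero_iff[OF Q(1) res M_zero[OF Q(1)], of j]
        killed Q(2) by blast
    have "f (Suc j) x = \<zero>\<^bsub>?F j\<^esub>" if x: "x \<in> carrier (?F (Suc j))" for x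
    proof
      fix b
      have fx: "f (Suc j) x \<in> carrier (?F j)"
        using res x by (auto simp: resolution_def mod_hom_def hom_def)
      have "f (Suc j) x b = \<zero>\<^bsub>R\<^esub>"
      proof (rule R.reduced_zero_if_locally_zero[OF assms(4)])
        show "f (Suc j) x b \<in> carrier R" using fx by (simp add: free_module_carrier_iff)
        fix Q assume Q: "locally_field_prime Q R"
        obtain u where "u \<in> carrier R - Q" "u \<odot>\<^bsub>?F j\<^esub> f (Suc j) x = \<zero>\<^bsub>?F j\<^esub>"
          using locally_field_prime.boundaries_locally_zero_iff[OF Q res M_zero[OF Q], of j]
            rank x by blast
        then show "\<exists>u\<in>carrier R - Q. u \<otimes>\<^bsub>R\<^esub> f (Suc j) x b = \<zero>\<^bsub>R\<^esub>"
          by (auto simp: free_module_simps fun_eq_iff)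
      qed
      then show "f (Suc j) x b = \<zero>\<^bsub>?F j\<^esub> b" by (simp add: free_module_simps)
    qed
    then have "proj_dim R M \<le> enat j" by (rule proj_dim_le_of_zero_boundary[OF res])
    then show False using assms(8) by simp
  qed
  then show "Supp R (Syz R \<beta> f i) = Spec R" by (auto simp: Supp_def)
qed

end
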